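(* Let $G$ be a compact topological group and let $P$ be a subgroup of $\mathrm{Aut}(G)$. Then the following two conditions are equivalent: (1) $G\leftthreetimes P$ is not minimal. (2) There exists a closed nontrivial subgroup $H$ of $G$ satisfying the following conditions: (a) $H\cap Z(G)=\{e_G\}$; (b) $H$ is $P$-invariant, that is, $f(H)\subseteq H$ for every $f\in P$; (c) $\Gamma(H)\subseteq\overline{P}$ and $\Gamma(H)\cap P=\{e_P\}$, where $\overline P$ is the closure of $P$ in $\mathrm{Aut}(G)$ and $\Gamma: G\to \mathrm{Inn}(G)$ is the natural homomorphism $\Gamma(g)=\gamma_g$.
   Context: All topological groups are Hausdorff. $\mathrm{Aut}(G)$ is the group of all topological automorphisms of $G$, equipped with the compact-open topology, which makes it a topological group; $\mathrm{Inn}(G)$ is its subgroup of inner automorphisms, $\gamma_g(x)=gxg^{-1}$, and $Z(G)$ is the center of $G$. $e_G$ and $e_P$ denote the identity elements of $G$ and $P$. For a subgroup $P\leq \mathrm{Aut}(G)$ (with the subspace topology), $G\leftthreetimes P$ denotes the set $G\times P$ with the product topology and the multiplication $(x,f)(y,g)=(x\cdot f(y),\, f\circ g)$. A Hausdorff topological group is minimal if it does not admit a strictly coarser Hausdorff group topology. *)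

theory Defs
  imports "HOL-Analysis.Analysis" "HOL-Algebra.Bij"
begin

locale topological_group = group G for G (structure) +
  fixes T :: "'a topology"
  assumes topspace_eq_carrier: "topspace T = carrier G"
    and Hausdorff: "Hausdorff_space T"
    and continuous_mult: "continuous_map (prod_topology T T) T (\<lambda>(x, y). x \<otimes> y)"
    and continuous_inv: "continuous_map T T (\<lambda>x. inv x)"

definition minimal_topological_group :: "('a, 'b) monoid_scheme \<Rightarrow> 'a topology \<Rightarrow> bool"
  where "minimal_topological_group G T \<longleftrightarrow>
    topological_group G T \<and>
    \<not> (\<exists>T'. topological_group G T' \<and> (\<forall>U. openin T' U \<longrightarrow> openin T U) \<and> T' \<noteq> T)"

definition center :: "('a, 'b) monoid_scheme \<Rightarrow> 'a set"
  where "center G = {z \<in> carrier G. \<forall>x \<in> carrier G. z \<otimes>\<^bsub>G\<^esub> x = x \<otimes>\<^bsub>G\<^esub> z}"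

text \<open>As in \<^theory>\<open>HOL-Algebra.Bij\<close>, automorphisms are extensional functions, so that two
  of them are equal iff they agree on the carrier. The product of \<^const>\<open>AutoGroup\<close> is composition.\<close>

definition Aut :: "('a, 'b) monoid_scheme \<Rightarrow> 'a topology \<Rightarrow> ('a \<Rightarrow> 'a) monoid"
  where "Aut G T = AutoGroup G \<lparr>carrier := {f \<in> auto G. homeomorphic_map T T f}\<rparr>"

definition Aut_topology :: "('a, 'b) monoid_scheme \<Rightarrow> 'a topology \<Rightarrow> ('a \<Rightarrow> 'a) topology"
  \<comment> \<open>The compact-open topology; taking \<open>K\<close> empty shows that its space is all of \<open>Aut G T\<close>.\<close>
  where "Aut_topology G T = topology_generated_by
    {{f \<in> carrier (Aut G T). f ` K \<subseteq> U} | K U. compactin T K \<and> openin T U}"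

definition inner_aut :: "('a, 'b) monoid_scheme \<Rightarrow> 'a \<Rightarrow> 'a \<Rightarrow> 'a"
  where "inner_aut G g = (\<lambda>x \<in> carrier G. g \<otimes>\<^bsub>G\<^esub> x \<otimes>\<^bsub>G\<^esub> inv\<^bsub>G\<^esub> g)"

definition semidirect ::
    "('a, 'b) monoid_scheme \<Rightarrow> 'a topology \<Rightarrow> ('a \<Rightarrow> 'a) set \<Rightarrow> ('a \<times> ('a \<Rightarrow> 'a)) monoid"
  where "semidirect G T P =
    \<lparr>carrier = carrier G \<times> P,
     mult = \<lambda>(x, f) (y, g). (x \<otimes>\<^bsub>G\<^esub> f y, f \<otimes>\<^bsub>Aut G T\<^esub> g),
     one = (\<one>\<^bsub>G\<^esub>, \<one>\<^bsub>Aut G T\<^esub>)\<rparr>"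

definition semidirect_topology ::
    "('a, 'b) monoid_scheme \<Rightarrow> 'a topology \<Rightarrow> ('a \<Rightarrow> 'a) set \<Rightarrow> ('a \<times> ('a \<Rightarrow> 'a)) topology"
  where "semidirect_topology G T P = prod_topology T (subtopology (Aut_topology G T) P)"

end

theory Submission
  imports Defs "HOL-Algebra.Coset"
begin

text \<open>
  Write \<open>S(P)\<close> for the semidirect product of \<open>G\<close> and \<open>P\<close>. Both directions take place in the
  holomorph \<open>S(Aut(G))\<close>, which contains \<open>S(P)\<close> as a topological subgroup. The holomorph acts
  on its normal subgroup \<open>G\<close> by conjugation: \<open>(x, f)\<close> acts as the automorphism \<open>\<gamma>\<^sub>x \<circ> f\<close>. The
  kernel of this action is the antidiagonal \<open>{(h\<^sup>-\<^sup>1, \<gamma>\<^sub>h) | h \<in> G}\<close>, a second copy of \<open>G\<close>,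
  and the subgroups \<open>H\<close> of the theorem correspond to certain subgroups \<open>N = {(h\<^sup>-\<^sup>1, \<gamma>\<^sub>h) | h
  \<in> H}\<close> of it. In terms of \<open>N\<close> the conditions on \<open>H\<close> say that \<open>N\<close> is a nontrivial closed
  subgroup that is normalised by \<open>S(P)\<close>, meets \<open>S(P)\<close> trivially and lies in the closure of
  \<open>S(P)\<close>.

  Given such an \<open>N\<close>, the quotient by \<open>N\<close> induces a strictly coarser Hausdorff group topology
  on \<open>S(P)\<close>. This is the lemma \<open>not_minimal_if_normal_in_closure\<close>, which holds for subgroups
  of arbitrary topological groups.

  Conversely, from a strictly coarser Hausdorff group topology on \<open>S(P)\<close> one obtains \<open>N\<close> as
  the set of limits in the holomorph of all nets in \<open>S(P)\<close> that converge to the identity in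
  the coarser topology. That \<open>N\<close> is a closed subgroup with the required position relative to
  \<open>S(P)\<close> is again general; the lemmas are those of the locale \<open>coarser_subgroup_topology\<close>.
  Beyond making \<open>Aut(G)\<close> a topological group, compactness of \<open>G\<close> enters here in two places.
  The coarser topology cannot change on \<open>G\<close>, hence the action on \<open>G\<close> is continuous for it, and
  therefore \<open>N\<close> lies in the kernel of the action. And if \<open>N\<close> were trivial, the first
  coordinates \<open>x\<close> of a net of elements \<open>(x, f)\<close> converging to the identity in the coarser
  topology would have only the identity as a cluster point, so they would converge to it;
  since \<open>\<gamma>\<^sub>x \<circ> f\<close> converges to the identity as well, so does \<open>f\<close>, and the two topologies
  coincide.
\<close>

section \<open>Topological groups\<close>

lemma continuous_map_prodE:
  assumes "continuous_map (prod_topology X Y) Z f" "openin Z W"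
    and "a \<in> topspace X" "b \<in> topspace Y" "f (a, b) \<in> W"
  obtains A B where "openin X A" "openin Y B" "a \<in> A" "b \<in> B"
    "\<And>x y. x \<in> A \<Longrightarrow> y \<in> B \<Longrightarrow> f (x, y) \<in> W"
proof -
  have "openin (prod_topology X Y) {z \<in> topspace (prod_topology X Y). f z \<in> W}"
    using assms(1,2) by (rule openin_continuous_map_preimage)
  moreover have "(a, b) \<in> {z \<in> topspace (prod_topology X Y). f z \<in> W}"
    using assms by simp
  ultimately show ?thesis
    unfolding openin_prod_topology_alt using that by (smt (verit) SigmaI mem_Collect_eq subsetD)
qed

lemma continuous_map_prodI:
  assumes "\<And>a b. a \<in> topspace X \<Longrightarrow> b \<in> topspace Y \<Longrightarrow> f (a, b) \<in> topspace Z"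
    and "\<And>a b W. \<lbrakk>openin Z W; a \<in> topspace X; b \<in> topspace Y; f (a, b) \<in> W\<rbrakk> \<Longrightarrow>
      \<exists>A B. openin X A \<and> openin Y B \<and> a \<in> A \<and> b \<in> B \<and> (\<forall>x\<in>A. \<forall>y\<in>B. f (x, y) \<in> W)"
  shows "continuous_map (prod_topology X Y) Z f"
  unfolding continuous_map_def
proof (intro conjI allI impI)
  show "f \<in> topspace (prod_topology X Y) \<rightarrow> topspace Z"
    using assms(1) by auto
  fix W assume W: "openin Z W"
  show "openin (prod_topology X Y) {z \<in> topspace (prod_topology X Y). f z \<in> W}"
    unfolding openin_prod_topology_alt
  proof (intro allI impI)
    fix a b assume "(a, b) \<in> {z \<in> topspace (prod_topology X Y). f z \<in> W}"
    then obtain A B where "openin X A" "openin Y B" "a \<in> A" "b \<in> B" "\<forall>x\<in>A. \<forall>y\<in>B. f (x, y) \<in> W"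
      using assms(2)[OF W, of a b] by auto
    moreover from this have "A \<times> B \<subseteq> {z \<in> topspace (prod_topology X Y). f z \<in> W}"
      by (auto dest: openin_subset)
    ultimately show "\<exists>A B. openin X A \<and> openin Y B \<and> a \<in> A \<and> b \<in> B \<and>
        A \<times> B \<subseteq> {z \<in> topspace (prod_topology X Y). f z \<in> W}"
      by blast
  qed
qed

lemma (in group) inv_mult_cancel:
  "\<lbrakk>x \<in> carrier G; z \<in> carrier G\<rbrakk> \<Longrightarrow> inv x \<otimes> (x \<otimes> z) = z"
  by (simp add: m_assoc[symmetric])

lemma (in group) mult_inv_cancel:
  "\<lbrakk>x \<in> carrier G; z \<in> carrier G\<rbrakk> \<Longrightarrow> x \<otimes> (inv x \<otimes> z) = z"
  by (simp add: m_assoc[symmetric])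

context topological_group
begin

lemma continuous_map_mult:
  assumes "continuous_map X T f" "continuous_map X T g"
  shows "continuous_map X T (\<lambda>z. f z \<otimes> g z)"
  using continuous_map_compose[OF _ continuous_mult, of X "\<lambda>z. (f z, g z)"] assms
  by (simp add: o_def continuous_map_paired)

lemma continuous_map_inv:
  assumes "continuous_map X T f"
  shows "continuous_map X T (\<lambda>z. inv f z)"
  using continuous_map_compose[OF assms continuous_inv] by (simp add: o_def)

lemma continuous_map_const_carrier: "g \<in> carrier G \<Longrightarrow> continuous_map X T (\<lambda>z. g)"
  by (simp add: topspace_eq_carrier)

lemmas group_continuous_intros = continuous_map_mult continuous_map_inv continuous_map_const_carrier

lemma open_subset_carrier: "openin T U \<Longrightarrow> U \<subseteq> carrier G"
  using openin_subset topspace_eq_carrier by metis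

lemma openin_preimage:
  "continuous_map T T f \<Longrightarrow> openin T U \<Longrightarrow> openin T {x \<in> carrier G. f x \<in> U}"
  using openin_continuous_map_preimage topspace_eq_carrier by metis

lemma topological_group_subgroup:
  assumes "subgroup M G"
  shows "topological_group (G\<lparr>carrier := M\<rparr>) (subtopology T M)"
proof -
  have sub: "M \<subseteq> topspace T"
    using assms subgroup.subset topspace_eq_carrier by metis
  show ?thesis
  proof (intro topological_group.intro topological_group_axioms.intro)
    show "group (G\<lparr>carrier := M\<rparr>)"
      using assms by (rule subgroup_imp_group)
    show "topspace (subtopology T M) = carrier (G\<lparr>carrier := M\<rparr>)"
      using sub by auto
    show "Hausdorff_space (subtopology T M)"
      using Hausdorff by (rule Hausdorff_space_subtopology)
    have "continuous_map (prod_topology (subtopology T M) (subtopology T M)) T (\<lambda>(x, y). x \<otimes> y)"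
      using continuous_map_from_subtopology[OF continuous_mult, of "M \<times> M"]
      by (simp add: subtopology_Times)
    then show "continuous_map (prod_topology (subtopology T M) (subtopology T M)) (subtopology T M)
        (\<lambda>(x, y). x \<otimes>\<^bsub>G\<lparr>carrier := M\<rparr>\<^esub> y)"
      using assms by (auto simp: continuous_map_in_subtopology subgroup.m_closed)
    have "continuous_map (subtopology T M) (subtopology T M) (\<lambda>x. inv x)"
      using continuous_map_from_subtopology[OF continuous_inv, of M] assms
      by (auto simp: continuous_map_in_subtopology subgroup.m_inv_closed)
    then show "continuous_map (subtopology T M) (subtopology T M) (\<lambda>x. inv\<^bsub>G\<lparr>carrier := M\<rparr>\<^esub> x)"
      by (rule continuous_map_eq) (simp add: assms)
  qed
qed

text \<open>Translations are homeomorphisms for both topologies, so it is enough to compare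
  neighbourhoods of the identity.\<close>
lemma finer_if_finer_at_one:
  assumes T': "topological_group G T'"
    and one: "\<And>V. openin T V \<Longrightarrow> \<one> \<in> V \<Longrightarrow> \<exists>U. openin T' U \<and> \<one> \<in> U \<and> U \<subseteq> V"
    and W: "openin T W"
  shows "openin T' W"
proof (subst openin_subopen, intro ballI)
  interpret T': topological_group G T' by (rule T')
  fix a assume a: "a \<in> W"
  then have ac: "a \<in> carrier G"
    using W open_subset_carrier by auto
  have "continuous_map T T (\<lambda>x. a \<otimes> x)"
    by (intro continuous_map_mult continuous_map_const_carrier ac) simp
  then have "openin T {x \<in> carrier G. a \<otimes> x \<in> W}"
    using W by (rule openin_preimage)
  then obtain U where U: "openin T' U" "\<one> \<in> U" "U \<subseteq> {x \<in> carrier G. a \<otimes> x \<in> W}"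
    using one ac a by (metis (no_types, lifting) mem_Collect_eq one_closed r_one)
  have "continuous_map T' T' (\<lambda>x. inv a \<otimes> x)"
    by (intro T'.continuous_map_mult T'.continuous_map_const_carrier inv_closed ac) simp
  then have "openin T' {x \<in> carrier G. inv a \<otimes> x \<in> U}"
    using U(1) by (rule T'.openin_preimage)
  moreover have "{x \<in> carrier G. inv a \<otimes> x \<in> U} \<subseteq> W"
  proof safe
    fix x assume x: "x \<in> carrier G" "inv a \<otimes> x \<in> U"
    then have "a \<otimes> (inv a \<otimes> x) \<in> W"
      using U(3) by auto
    then show "x \<in> W"
      using x ac by (simp add: m_assoc[symmetric])
  qed
  moreover have "a \<in> {x \<in> carrier G. inv a \<otimes> x \<in> U}"
    using ac U(2) by simp
  ultimately show "\<exists>V. openin T' V \<and> a \<in> V \<and> V \<subseteq> W"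
    by blast
qed

lemma openin_set_mult:
  assumes "openin T A" "N \<subseteq> carrier G"
  shows "openin T (A <#> N)"
proof -
  have "A <#> N = (\<Union>n\<in>N. {x \<in> carrier G. x \<otimes> inv n \<in> A})"
  proof (intro equalityI subsetI)
    fix x assume "x \<in> A <#> N"
    then obtain a n where an: "a \<in> A" "n \<in> N" "x = a \<otimes> n"
      by (auto simp: set_mult_def)
    moreover from this have "a \<in> carrier G" "n \<in> carrier G"
      using assms open_subset_carrier by auto
    ultimately show "x \<in> (\<Union>n\<in>N. {x \<in> carrier G. x \<otimes> inv n \<in> A})"
      by (auto simp: m_assoc intro!: bexI[of _ n])
  next
    fix x assume "x \<in> (\<Union>n\<in>N. {x \<in> carrier G. x \<otimes> inv n \<in> A})"
    then obtain n where n: "n \<in> N" "x \<in> carrier G" "x \<otimes> inv n \<in> A"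
      by auto
    moreover from this have "n \<in> carrier G"
      using assms by auto
    moreover from this n have "x = (x \<otimes> inv n) \<otimes> n"
      by (simp add: m_assoc)
    ultimately show "x \<in> A <#> N"
      unfolding set_mult_def by blast
  qed
  moreover have "openin T {x \<in> carrier G. x \<otimes> inv n \<in> A}" if "n \<in> N" for n
    using that assms by (intro openin_preimage group_continuous_intros) auto
  ultimately show ?thesis
    by auto
qed

section \<open>Normal subgroups inside the closure of a subgroup\<close>

text \<open>The coarser topology on \<open>M\<close> is the one that \<open>M\<close> inherits from the quotient \<open>G / N\<close>: the
  composite \<open>M \<rightarrow> G \<rightarrow> G / N\<close> is injective because \<open>N \<inter> M\<close> is trivial, and \<open>G / N\<close> is Hausdorff
  because \<open>N\<close> is closed. It differs from the given topology because an open set that contains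
  the identity and is a union of cosets of \<open>N\<close> is a neighbourhood of every \<open>n \<in> N\<close>, hence meets
  \<open>M\<close> arbitrarily close to \<open>n\<close>.\<close>
theorem not_minimal_if_normal_in_closure:
  assumes M: "subgroup M G" and N: "N \<lhd> G" and closed: "closedin T N" and nontriv: "N \<noteq> {\<one>}"
    and inter: "N \<inter> M = {\<one>}" and dense: "N \<subseteq> T closure_of M"
  shows "\<not> minimal_topological_group (G\<lparr>carrier := M\<rparr>) (subtopology T M)"
proof -
  interpret N: normal N G by (rule N)
  have MG: "M \<subseteq> carrier G" using M by (rule subgroup.subset)
  \<comment> \<open>Saturated open sets are the preimages of the open subsets of \<open>G / N\<close>. Describing the quotient
    topology by them keeps all arguments inside \<open>G\<close>.\<close>
  define saturated where
    "saturated W \<longleftrightarrow> openin T W \<and> (\<forall>w\<in>W. \<forall>n\<in>N. w \<otimes> n \<in> W)" for W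
  define T' where "T' = topology (\<lambda>V. \<exists>W. saturated W \<and> V = W \<inter> M)"
  have "istopology (\<lambda>V. \<exists>W. saturated W \<and> V = W \<inter> M)"
    unfolding istopology_def
  proof (intro conjI allI impI)
    fix V V' assume "\<exists>W. saturated W \<and> V = W \<inter> M" "\<exists>W. saturated W \<and> V' = W \<inter> M"
    then obtain W W' where "saturated W" "V = W \<inter> M" "saturated W'" "V' = W' \<inter> M"
      by auto
    then have "saturated (W \<inter> W') \<and> V \<inter> V' = (W \<inter> W') \<inter> M"
      unfolding saturated_def by auto
    then show "\<exists>W. saturated W \<and> V \<inter> V' = W \<inter> M"
      by blast
  next
    fix \<V> assume "\<forall>V\<in>\<V>. \<exists>W. saturated W \<and> V = W \<inter> M"
    then obtain w where w: "\<And>V. V \<in> \<V> \<Longrightarrow> saturated (w V) \<and> V = w V \<inter> M"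
      by metis
    have "saturated (\<Union>(w ` \<V>))"
      unfolding saturated_def
    proof (intro conjI ballI)
      show "openin T (\<Union>(w ` \<V>))"
        using w unfolding saturated_def by blast
      show "a \<otimes> n \<in> \<Union>(w ` \<V>)" if "a \<in> \<Union>(w ` \<V>)" "n \<in> N" for a n
        using that w unfolding saturated_def by blast
    qed
    moreover have "\<Union>\<V> = \<Union>(w ` \<V>) \<inter> M"
      using w by blast
    ultimately show "\<exists>W. saturated W \<and> \<Union>\<V> = W \<inter> M"
      by blast
  qed
  then have openin_T': "openin T' V \<longleftrightarrow> (\<exists>W. saturated W \<and> V = W \<inter> M)" for V
    unfolding T'_def by (simp add: topology_inverse')
  have saturated_hull: "saturated (A <#> N)" if "openin T A" for A
    unfolding saturated_def
  proof (intro conjI ballI)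
    show "openin T (A <#> N)"
      using that N.subset by (rule openin_set_mult)
    fix w n assume w: "w \<in> A <#> N" and n: "n \<in> N"
    then obtain a n' where a: "a \<in> A" "n' \<in> N" "w = a \<otimes> n'"
      by (auto simp: set_mult_def)
    then have "w \<otimes> n = a \<otimes> (n' \<otimes> n)"
      using n open_subset_carrier[OF that] by (simp add: m_assoc subset_iff)
    then show "w \<otimes> n \<in> A <#> N"
      unfolding set_mult_def using a n N.m_closed by blast
  qed
  have open_hull: "openin T' ((A <#> N) \<inter> M)" if "openin T A" for A
    unfolding openin_T' using saturated_hull[OF that] by blast
  have mem_hull: "a \<in> A <#> N" if "openin T A" "a \<in> A" for A a
  proof -
    have "a \<otimes> \<one> \<in> A <#> N"
      unfolding set_mult_def using N.one_closed that(2) by blast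
    then show ?thesis
      using open_subset_carrier[OF that(1)] that(2) by auto
  qed
  have topspace_T': "topspace T' = M"
  proof
    show "topspace T' \<subseteq> M"
      using openin_topspace[of T'] unfolding openin_T' by auto
    have "saturated (carrier G)"
      unfolding saturated_def using openin_topspace[of T] by (simp add: topspace_eq_carrier)
    then have "openin T' M"
      unfolding openin_T' using MG by blast
    then show "M \<subseteq> topspace T'"
      by (rule openin_subset)
  qed
  have coarser: "openin (subtopology T M) V" if "openin T' V" for V
    using that unfolding openin_T' saturated_def openin_subtopology by auto
  have group_T': "topological_group (G\<lparr>carrier := M\<rparr>) T'"
  proof (intro topological_group.intro topological_group_axioms.intro)
    show "group (G\<lparr>carrier := M\<rparr>)"
      using M by (rule subgroup_imp_group)
    show "topspace T' = carrier (G\<lparr>carrier := M\<rparr>)"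
      by (simp add: topspace_T')
    show "Hausdorff_space T'"
      unfolding Hausdorff_space_def topspace_T'
    proof (intro allI impI, elim conjE)
      fix a b assume ab: "a \<in> M" "b \<in> M" "a \<noteq> b"
      then have abG: "a \<in> carrier G" "b \<in> carrier G"
        using MG by auto
      have "inv a \<otimes> b \<notin> N"
      proof
        assume "inv a \<otimes> b \<in> N"
        then have "inv a \<otimes> b = \<one>"
          using inter M ab by (metis IntI empty_iff insert_iff subgroup.m_closed subgroup.m_inv_closed)
        then show False
          using ab(3) abG by (metis inv_equality inv_inv inv_closed)
      qed
      moreover have "openin T (carrier G - N)"
        using closed openin_diff openin_topspace topspace_eq_carrier by metis
      moreover have "continuous_map (prod_topology T T) T (\<lambda>z. inv (fst z) \<otimes> snd z)"
        by (intro group_continuous_intros continuous_map_fst continuous_map_snd)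
      ultimately obtain A B where AB: "openin T A" "openin T B" "a \<in> A" "b \<in> B"
        "\<And>x y. x \<in> A \<Longrightarrow> y \<in> B \<Longrightarrow> inv x \<otimes> y \<in> carrier G - N"
        using continuous_map_prodE[of T T T "\<lambda>z. inv (fst z) \<otimes> snd z" "carrier G - N" a b] abG
        by (auto simp: topspace_eq_carrier)
      have "disjnt (A <#> N) (B <#> N)"
        unfolding disjnt_iff
      proof (intro allI notI, elim conjE)
        fix z assume "z \<in> A <#> N" "z \<in> B <#> N"
        then obtain x n y m where z: "x \<in> A" "n \<in> N" "y \<in> B" "m \<in> N" "z = x \<otimes> n" "x \<otimes> n = y \<otimes> m"
          by (auto simp: set_mult_def)
        then have xy: "x \<in> carrier G" "y \<in> carrier G"
          using AB(1,2) open_subset_carrier by auto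
        have nm: "n \<in> carrier G" "m \<in> carrier G"
          using z by auto
        have "y = x \<otimes> n \<otimes> inv m"
          using z(6) xy nm by (simp add: m_assoc)
        then have "inv x \<otimes> y = n \<otimes> inv m"
          using xy nm by (simp add: m_assoc inv_mult_cancel)
        then have "inv x \<otimes> y \<in> N"
          using z by simp
        then show False
          using AB(5) z by blast
      qed
      then have "disjnt ((A <#> N) \<inter> M) ((B <#> N) \<inter> M)"
        unfolding disjnt_iff by blast
      then show "\<exists>U V. openin T' U \<and> openin T' V \<and> a \<in> U \<and> b \<in> V \<and> disjnt U V"
        using open_hull[OF AB(1)] open_hull[OF AB(2)] mem_hull[OF AB(1,3)] mem_hull[OF AB(2,4)] ab(1,2)
        by (meson IntI)
    qed
    show "continuous_map (prod_topology T' T') T' (\<lambda>(x, y). x \<otimes>\<^bsub>G\<lparr>carrier := M\<rparr>\<^esub> y)"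
    proof (rule continuous_map_prodI)
      fix a b V assume V: "openin T' V" and ab: "a \<in> topspace T'" "b \<in> topspace T'"
        and "(case (a, b) of (x, y) \<Rightarrow> x \<otimes>\<^bsub>G\<lparr>carrier := M\<rparr>\<^esub> y) \<in> V"
      then obtain W where W: "saturated W" "V = W \<inter> M" "a \<otimes> b \<in> W"
        unfolding openin_T' by auto
      have ab: "a \<in> M" "b \<in> M" "a \<in> carrier G" "b \<in> carrier G"
        using ab MG topspace_T' by auto
      obtain A B where AB: "openin T A" "openin T B" "a \<in> A" "b \<in> B"
        "\<And>x y. x \<in> A \<Longrightarrow> y \<in> B \<Longrightarrow> x \<otimes> y \<in> W"
        using continuous_map_prodE[OF continuous_mult, of W a b] W ab
        unfolding saturated_def by (auto simp: topspace_eq_carrier)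
      have "x \<otimes> y \<in> W" if xy: "x \<in> A <#> N" "y \<in> B <#> N" for x y
      proof -
        obtain x' n y' m where z: "x' \<in> A" "n \<in> N" "y' \<in> B" "m \<in> N" "x = x' \<otimes> n" "y = y' \<otimes> m"
          using xy by (auto simp: set_mult_def)
        then have c: "x' \<in> carrier G" "y' \<in> carrier G" "n \<in> carrier G" "m \<in> carrier G"
          using AB(1,2) open_subset_carrier by auto
        \<comment> \<open>Normality lets the factor \<open>n\<close> be moved to the right past \<open>y'\<close>.\<close>
        have "x \<otimes> y = (x' \<otimes> y') \<otimes> ((inv y' \<otimes> n \<otimes> y') \<otimes> m)"
          using z(5,6) c by (simp add: m_assoc mult_inv_cancel)
        moreover have "(inv y' \<otimes> n \<otimes> y') \<otimes> m \<in> N"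
          using z c N.inv_op_closed1 N.m_closed by auto
        moreover have "x' \<otimes> y' \<in> W"
          using z AB(5) by blast
        ultimately show ?thesis
          using W(1) unfolding saturated_def by auto
      qed
      then have "\<forall>x\<in>(A <#> N) \<inter> M. \<forall>y\<in>(B <#> N) \<inter> M. x \<otimes> y \<in> V"
        using W(2) subgroup.m_closed[OF M] by blast
      then show "\<exists>A B. openin T' A \<and> openin T' B \<and> a \<in> A \<and> b \<in> B \<and>
          (\<forall>x\<in>A. \<forall>y\<in>B. (case (x, y) of (x, y) \<Rightarrow> x \<otimes>\<^bsub>G\<lparr>carrier := M\<rparr>\<^esub> y) \<in> V)"
        using open_hull[OF AB(1)] open_hull[OF AB(2)] mem_hull[OF AB(1,3)] mem_hull[OF AB(2,4)] ab(1,2)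
        by (simp add: exI[of _ "(A <#> N) \<inter> M"]) (meson IntI)
    qed (use M in \<open>auto simp: topspace_T' subgroup.m_closed\<close>)
    show "continuous_map T' T' (\<lambda>x. inv\<^bsub>G\<lparr>carrier := M\<rparr>\<^esub> x)"
      unfolding continuous_map_def topspace_T'
    proof (intro conjI allI impI)
      show "m_inv (G\<lparr>carrier := M\<rparr>) \<in> M \<rightarrow> M"
        using M by (auto simp: subgroup.m_inv_closed)
      fix V assume "openin T' V"
      then obtain W where W: "saturated W" "V = W \<inter> M"
        unfolding openin_T' by auto
      have "saturated {x \<in> carrier G. inv x \<in> W}"
        unfolding saturated_def
      proof (intro conjI ballI)
        show "openin T {x \<in> carrier G. inv x \<in> W}"
          using W continuous_inv unfolding saturated_def by (intro openin_preimage) auto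
        fix w n assume w: "w \<in> {x \<in> carrier G. inv x \<in> W}" and n: "n \<in> N"
        then have c: "w \<in> carrier G" "n \<in> carrier G"
          by auto
        have "inv (w \<otimes> n) = inv w \<otimes> (w \<otimes> inv n \<otimes> inv w)"
          using c by (simp add: inv_mult_group m_assoc[symmetric])
        moreover have "w \<otimes> inv n \<otimes> inv w \<in> N"
          using c n N.inv_op_closed2 by auto
        ultimately show "w \<otimes> n \<in> {x \<in> carrier G. inv x \<in> W}"
          using W(1) w c unfolding saturated_def by auto
      qed
      moreover have "{x \<in> M. inv\<^bsub>G\<lparr>carrier := M\<rparr>\<^esub> x \<in> V} = {x \<in> carrier G. inv x \<in> W} \<inter> M"
        using W(2) M MG by (auto simp: subgroup.m_inv_closed)
      ultimately show "openin T' {x \<in> M. inv\<^bsub>G\<lparr>carrier := M\<rparr>\<^esub> x \<in> V}"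
        unfolding openin_T' by blast
    qed
  qed
  have "T' \<noteq> subtopology T M"
  proof
    assume eq: "T' = subtopology T M"
    \<comment> \<open>Separate the identity from a nontrivial \<open>n \<in> N\<close> by disjoint \<open>U\<close> and \<open>V\<close>. If the trace of \<open>U\<close>
      on \<open>M\<close> were the trace of a saturated set, this set would contain \<open>n\<close>, so that points of \<open>M\<close>
      in \<open>V\<close> would lie in \<open>U\<close>.\<close>
    obtain n where n: "n \<in> N" "n \<noteq> \<one>"
      using nontriv N.one_closed by blast
    then have "n \<in> carrier G"
      by auto
    then obtain U V where UV: "openin T U" "openin T V" "\<one> \<in> U" "n \<in> V" "disjnt U V"
      using Hausdorff n(2) unfolding Hausdorff_space_def topspace_eq_carrier
      by (metis one_closed)
    then have "openin T' (U \<inter> M)"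
      unfolding eq openin_subtopology by auto
    then obtain W where W: "saturated W" "U \<inter> M = W \<inter> M"
      unfolding openin_T' by auto
    have "\<one> \<in> W"
      using W(2) UV(3) subgroup.one_closed[OF M] by auto
    then have "\<one> \<otimes> n \<in> W"
      using W(1) n(1) unfolding saturated_def by blast
    then have "n \<in> W"
      using \<open>n \<in> carrier G\<close> by simp
    then have "n \<in> W \<inter> V" "openin T (W \<inter> V)"
      using W UV unfolding saturated_def by auto
    moreover have "n \<in> T closure_of M"
      using dense n(1) by (rule subsetD)
    ultimately obtain m where "m \<in> M" "m \<in> W \<inter> V"
      unfolding in_closure_of by blast
    then have "m \<in> U" "m \<in> V"
      using W(2) by auto
    then show False
      using UV(5) unfolding disjnt_iff by simp
  qed
  then have "\<exists>T'. topological_group (G\<lparr>carrier := M\<rparr>) T' \<and>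
      (\<forall>U. openin T' U \<longrightarrow> openin (subtopology T M) U) \<and> T' \<noteq> subtopology T M"
    using group_T' coarser by (intro exI[of _ T']) simp
  then show ?thesis
    unfolding minimal_topological_group_def by simp
qed

end

section \<open>The adherence of a coarser neighbourhood filter\<close>

text \<open>All cluster points, with respect to \<open>T\<close>, of the filter of \<open>T'\<close>-neighbourhoods of \<open>a\<close>. Here
  \<open>T'\<close> may live on a smaller set than \<open>T\<close>.\<close>
definition nhds_adherence :: "'a topology \<Rightarrow> 'a topology \<Rightarrow> 'a \<Rightarrow> 'a set" where
  "nhds_adherence T T' a = (\<Inter>U\<in>{U. openin T' U \<and> a \<in> U}. T closure_of U)"

lemma in_nhds_adherenceD:
  "\<lbrakk>x \<in> nhds_adherence T T' a; openin T' U; a \<in> U\<rbrakk> \<Longrightarrow> x \<in> T closure_of U"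
  by (auto simp: nhds_adherence_def)

lemma in_nhds_adherenceI:
  "(\<And>U. \<lbrakk>openin T' U; a \<in> U\<rbrakk> \<Longrightarrow> x \<in> T closure_of U) \<Longrightarrow> x \<in> nhds_adherence T T' a"
  by (auto simp: nhds_adherence_def)

text \<open>A converse to the previous construction: a coarser Hausdorff group topology \<open>T'\<close> on a subgroup
  \<open>M\<close> of \<open>G\<close> produces a closed subgroup of \<open>G\<close>, called the core below, which lies in the closure
  of \<open>M\<close>, is normalised by \<open>M\<close> and meets \<open>M\<close> trivially. It consists of the limits in \<open>G\<close> of the
  nets in \<open>M\<close> that converge to the identity for \<open>T'\<close>.\<close>
locale coarser_subgroup_topology = topological_group G T for G (structure) and T +
  fixes M and T'
  assumes subgroup_M: "subgroup M G"
    and group_T': "topological_group (G\<lparr>carrier := M\<rparr>) T'"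
    and coarser: "openin T' U \<Longrightarrow> openin (subtopology T M) U"
begin

sublocale T': topological_group "G\<lparr>carrier := M\<rparr>" T'
  by (rule group_T')

abbreviation core where "core \<equiv> nhds_adherence T T' \<one>"

lemma topspace_T': "topspace T' = M"
  using T'.topspace_eq_carrier by simp

lemma M_subset: "M \<subseteq> carrier G"
  using subgroup_M by (rule subgroup.subset)

lemma T'_open_subset: "openin T' U \<Longrightarrow> U \<subseteq> M"
  using openin_subset topspace_T' by metis

lemma one_in_M: "\<one> \<in> M"
  using subgroup_M by (rule subgroup.one_closed)

lemma core_subset_closure: "core \<subseteq> T closure_of M"
  using in_nhds_adherenceD[of _ T T' \<one> M] openin_topspace[of T'] topspace_T' one_in_M by auto

lemma closedin_core: "closedin T core"
  unfolding nhds_adherence_def using openin_topspace[of T'] topspace_T' one_in_M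
  by (intro closedin_Inter) auto

lemma core_subset: "core \<subseteq> carrier G"
  using closedin_subset[OF closedin_core] topspace_eq_carrier by simp

text \<open>A point \<open>x \<noteq> \<one>\<close> of \<open>M\<close> has a \<open>T'\<close>-neighbourhood, hence a \<open>T\<close>-neighbourhood, that misses
  some \<open>T'\<close>-neighbourhood of the identity.\<close>
lemma core_Int_M: "core \<inter> M = {\<one>}"
proof (intro equalityI subsetI)
  fix x assume x: "x \<in> core \<inter> M"
  show "x \<in> {\<one>}"
  proof (rule ccontr)
    assume "x \<notin> {\<one>}"
    then obtain U V where UV: "openin T' U" "openin T' V" "\<one> \<in> U" "x \<in> V" "disjnt U V"
      using T'.Hausdorff x one_in_M unfolding Hausdorff_space_def topspace_T'
      by (metis IntE singletonI)
    obtain W where W: "openin T W" "V = W \<inter> M"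
      using coarser[OF UV(2)] unfolding openin_subtopology by auto
    have "x \<in> T closure_of U"
      using x UV(1,3) in_nhds_adherenceD by auto
    then obtain y where "y \<in> U" "y \<in> W"
      using W UV(4) unfolding in_closure_of by blast
    then show False
      using UV(5) W(2) T'_open_subset[OF UV(1)] unfolding disjnt_iff by blast
  qed
next
  fix x assume "x \<in> {\<one>}"
  moreover have "\<one> \<in> core"
  proof (rule in_nhds_adherenceI)
    fix U assume "openin T' U" "\<one> \<in> U"
    then show "\<one> \<in> T closure_of U"
      using closure_of_subset[of U T] T'_open_subset M_subset topspace_eq_carrier by blast
  qed
  ultimately show "x \<in> core \<inter> M"
    using one_in_M by simp
qed

text \<open>Closedness under the operations passes from the neighbourhood filter to its adherence,
  because continuous maps send closures into closures.\<close>
lemma subgroup_core: "subgroup core G"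
proof (rule subgroupI)
  show "core \<subseteq> carrier G" "core \<noteq> {}"
    using core_subset core_Int_M by auto
next
  fix a assume a: "a \<in> core"
  show "inv a \<in> core"
  proof (rule in_nhds_adherenceI)
    fix U assume U: "openin T' U" "\<one> \<in> U"
    define V where "V = {x \<in> M. inv x \<in> U}"
    have "openin T' {x \<in> carrier (G\<lparr>carrier := M\<rparr>). inv\<^bsub>G\<lparr>carrier := M\<rparr>\<^esub> x \<in> U}"
      by (rule T'.openin_preimage[OF T'.continuous_inv U(1)])
    also have "{x \<in> carrier (G\<lparr>carrier := M\<rparr>). inv\<^bsub>G\<lparr>carrier := M\<rparr>\<^esub> x \<in> U} = V"
      using subgroup_M by (auto simp: V_def)
    finally have "a \<in> T closure_of V"
      using in_nhds_adherenceD[OF a] U(2) one_in_M by (simp add: V_def)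
    then have "inv a \<in> T closure_of (m_inv G ` V)"
      using continuous_map_image_closure_subset[OF continuous_inv] by blast
    then show "inv a \<in> T closure_of U"
      using closure_of_mono[of "m_inv G ` V" U T] by (auto simp: V_def)
  qed
next
  fix a b assume ab: "a \<in> core" "b \<in> core"
  show "a \<otimes> b \<in> core"
  proof (rule in_nhds_adherenceI)
    fix U assume U: "openin T' U" "\<one> \<in> U"
    obtain A B where AB: "openin T' A" "openin T' B" "\<one> \<in> A" "\<one> \<in> B"
      "\<And>x y. x \<in> A \<Longrightarrow> y \<in> B \<Longrightarrow> x \<otimes> y \<in> U"
      using continuous_map_prodE[OF T'.continuous_mult U(1), of \<one> \<one>] U(2) one_in_M
      by (auto simp: topspace_T')
    have "a \<in> T closure_of A" "b \<in> T closure_of B"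
      using in_nhds_adherenceD[OF ab(1) AB(1,3)] in_nhds_adherenceD[OF ab(2) AB(2,4)] .
    then have "(a, b) \<in> prod_topology T T closure_of (A \<times> B)"
      by (simp add: closure_of_Times)
    moreover have sub: "(\<lambda>(x, y). x \<otimes> y) ` (A \<times> B) \<subseteq> U"
      using AB(5) by auto
    ultimately have "a \<otimes> b \<in> T closure_of ((\<lambda>(x, y). x \<otimes> y) ` (A \<times> B))"
      using continuous_map_image_closure_subset[OF continuous_mult, of "A \<times> B"] by force
    then show "a \<otimes> b \<in> T closure_of U"
      using closure_of_mono[OF sub, of T] by (rule subsetD[rotated])
  qed
qed

lemma conjugate_core:
  assumes m: "m \<in> M" and a: "a \<in> core"
  shows "m \<otimes> a \<otimes> inv m \<in> core"
proof (rule in_nhds_adherenceI)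
  fix U assume U: "openin T' U" "\<one> \<in> U"
  have mG: "m \<in> carrier G"
    using m M_subset by auto
  define V where "V = {x \<in> M. m \<otimes> x \<otimes> inv m \<in> U}"
  have "continuous_map T' T' (\<lambda>x. m \<otimes>\<^bsub>G\<lparr>carrier := M\<rparr>\<^esub> x \<otimes>\<^bsub>G\<lparr>carrier := M\<rparr>\<^esub> inv m)"
    using m subgroup_M
    by (intro T'.continuous_map_mult T'.continuous_map_const_carrier)
      (auto simp: subgroup.m_inv_closed)
  from T'.openin_preimage[OF this U(1)] have "openin T' V"
    by (simp add: V_def)
  then have "a \<in> T closure_of V"
    using in_nhds_adherenceD[OF a] U(2) one_in_M mG by (simp add: V_def)
  moreover have "continuous_map T T (\<lambda>x. m \<otimes> x \<otimes> inv m)"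
    using mG by (intro group_continuous_intros) auto
  ultimately have "m \<otimes> a \<otimes> inv m \<in> T closure_of ((\<lambda>x. m \<otimes> x \<otimes> inv m) ` V)"
    using continuous_map_image_closure_subset by blast
  then show "m \<otimes> a \<otimes> inv m \<in> T closure_of U"
    using closure_of_mono[of "(\<lambda>x. m \<otimes> x \<otimes> inv m) ` V" U T] by (auto simp: V_def)
qed

end

section \<open>The topological automorphism group of a compact group\<close>

context topological_group
begin

lemma Aut_eq: "Aut G T = AutoGroup G\<lparr>carrier := carrier (Aut G T)\<rparr>"
  by (simp add: Aut_def)

lemma in_Aut_iff:
  "f \<in> carrier (Aut G T) \<longleftrightarrow>
    f \<in> hom G G \<and> f \<in> extensional (carrier G) \<and> bij_betw f (carrier G) (carrier G) \<and>
    homeomorphic_map T T f"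
  by (auto simp: Aut_def auto_def Bij_def)

lemma Aut_closed: "\<lbrakk>f \<in> carrier (Aut G T); x \<in> carrier G\<rbrakk> \<Longrightarrow> f x \<in> carrier G"
  by (auto simp: in_Aut_iff hom_def)

lemma Aut_hom:
  "\<lbrakk>f \<in> carrier (Aut G T); x \<in> carrier G; y \<in> carrier G\<rbrakk> \<Longrightarrow> f (x \<otimes> y) = f x \<otimes> f y"
  by (auto simp: in_Aut_iff hom_def)

lemma Aut_continuous: "f \<in> carrier (Aut G T) \<Longrightarrow> continuous_map T T f"
  by (auto simp: in_Aut_iff homeomorphic_imp_continuous_map)

lemma Aut_eqI:
  "\<lbrakk>f \<in> carrier (Aut G T); g \<in> carrier (Aut G T); \<And>x. x \<in> carrier G \<Longrightarrow> f x = g x\<rbrakk> \<Longrightarrow> f = g"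
  by (auto simp: in_Aut_iff intro: extensionalityI)

lemma Aut_mult_apply:
  "\<lbrakk>f \<in> carrier (Aut G T); g \<in> carrier (Aut G T); x \<in> carrier G\<rbrakk> \<Longrightarrow>
    (f \<otimes>\<^bsub>Aut G T\<^esub> g) x = f (g x)"
  by (auto simp: Aut_def AutoGroup_def BijGroup_def auto_def compose_def)

lemma Aut_one_apply: "x \<in> carrier G \<Longrightarrow> \<one>\<^bsub>Aut G T\<^esub> x = x"
  by (simp add: Aut_def AutoGroup_def BijGroup_def)

lemma group_Aut: "group (Aut G T)"
proof -
  interpret AG: group "AutoGroup G"
    by (rule AutoGroup)
  have "subgroup (carrier (Aut G T)) (AutoGroup G)"
  proof (rule AG.subgroupI)
    show "carrier (Aut G T) \<subseteq> carrier (AutoGroup G)"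
      by (auto simp: Aut_def AutoGroup_def)
    have "homeomorphic_map T T (\<lambda>x\<in>carrier G. x)"
      by (rule homeomorphic_map_eq[of T T id]) (auto simp: topspace_eq_carrier)
    then show "carrier (Aut G T) \<noteq> {}"
      using id_in_auto by (auto simp: Aut_def)
  next
    fix f assume f: "f \<in> carrier (Aut G T)"
    then have fa: "f \<in> auto G" "f \<in> carrier (AutoGroup G)" and fh: "homeomorphic_map T T f"
      by (auto simp: Aut_def AutoGroup_def)
    have inv_f: "inv\<^bsub>AutoGroup G\<^esub> f = (\<lambda>x\<in>carrier G. inv_into (carrier G) f x)"
      using fa(1) unfolding AutoGroup_def
      by (subst group.m_inv_consistent[OF group_BijGroup subgroup_auto])
        (auto simp: auto_def inv_BijGroup)
    obtain g where g: "homeomorphic_maps T T f g"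
      using fh homeomorphic_map_maps[of T T f] by auto
    have "homeomorphic_map T T (inv\<^bsub>AutoGroup G\<^esub> f)"
    proof (rule homeomorphic_map_eq)
      show "homeomorphic_map T T g"
        using g homeomorphic_maps_sym homeomorphic_map_maps by metis
      fix y assume y: "y \<in> topspace T"
      then have "g y \<in> carrier G" "f (g y) = y"
        using g by (auto simp: homeomorphic_maps_def continuous_map_def topspace_eq_carrier)
      moreover have "inj_on f (carrier G)"
        using f by (auto simp: in_Aut_iff bij_betw_def)
      ultimately show "g y = (inv\<^bsub>AutoGroup G\<^esub> f) y"
        using y by (simp add: inv_f inv_into_f_eq topspace_eq_carrier)
    qed
    moreover have "inv\<^bsub>AutoGroup G\<^esub> f \<in> auto G"
      using AG.inv_closed[OF fa(2)] by (simp add: AutoGroup_def)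
    ultimately show "inv\<^bsub>AutoGroup G\<^esub> f \<in> carrier (Aut G T)"
      by (simp add: Aut_def)
  next
    fix f g assume fg: "f \<in> carrier (Aut G T)" "g \<in> carrier (Aut G T)"
    then have "f \<otimes>\<^bsub>AutoGroup G\<^esub> g \<in> auto G"
      using AG.m_closed[of f g] by (simp add: AutoGroup_def Aut_def)
    moreover have "homeomorphic_map T T (f \<otimes>\<^bsub>AutoGroup G\<^esub> g)"
    proof (rule homeomorphic_map_eq)
      show "homeomorphic_map T T (f \<circ> g)"
        using fg by (auto simp: Aut_def intro: homeomorphic_map_compose)
      show "(f \<circ> g) x = (f \<otimes>\<^bsub>AutoGroup G\<^esub> g) x" if "x \<in> topspace T" for x
        using that fg Aut_mult_apply[OF fg] by (simp add: topspace_eq_carrier Aut_def)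
    qed
    ultimately show "f \<otimes>\<^bsub>AutoGroup G\<^esub> g \<in> carrier (Aut G T)"
      by (simp add: Aut_def)
  qed
  then show ?thesis
    using AG.subgroup_imp_group Aut_eq by metis
qed

sublocale Aut: group "Aut G T"
  by (rule group_Aut)

lemma Aut_inv_apply:
  assumes "f \<in> carrier (Aut G T)" "x \<in> carrier G"
  shows "(inv\<^bsub>Aut G T\<^esub> f) (f x) = x" "f ((inv\<^bsub>Aut G T\<^esub> f) x) = x"
  using assms by (metis Aut.inv_closed Aut.l_inv Aut.r_inv Aut_mult_apply Aut_one_apply)+

lemma Aut_apply_one: "f \<in> carrier (Aut G T) \<Longrightarrow> f \<one> = \<one>"
  using hom_one[OF _ is_group is_group] by (auto simp: in_Aut_iff)

lemma Aut_apply_inv: "\<lbrakk>f \<in> carrier (Aut G T); x \<in> carrier G\<rbrakk> \<Longrightarrow> f (inv x) = inv f x"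
  by (metis Aut_apply_one Aut_closed Aut_hom inv_closed inv_equality l_inv)

lemma topspace_Aut_topology: "topspace (Aut_topology G T) = carrier (Aut G T)"
proof
  show "topspace (Aut_topology G T) \<subseteq> carrier (Aut G T)"
    unfolding Aut_topology_def by auto
  have "carrier (Aut G T) \<in> {{f \<in> carrier (Aut G T). f ` K \<subseteq> U} | K U. compactin T K \<and> openin T U}"
    by (intro CollectI exI[of _ "{}"]) auto
  then show "carrier (Aut G T) \<subseteq> topspace (Aut_topology G T)"
    unfolding Aut_topology_def topology_generated_by_topspace by blast
qed

lemma openin_Aut_topology_basic:
  "\<lbrakk>compactin T K; openin T U\<rbrakk> \<Longrightarrow> openin (Aut_topology G T) {f \<in> carrier (Aut G T). f ` K \<subseteq> U}"
  unfolding Aut_topology_def by (rule topology_generated_by_Basis) blast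

lemma continuous_map_into_AutI:
  assumes "\<And>z. z \<in> topspace X \<Longrightarrow> \<phi> z \<in> carrier (Aut G T)"
    and "\<And>K U. \<lbrakk>compactin T K; openin T U\<rbrakk> \<Longrightarrow> openin X {z \<in> topspace X. \<phi> z ` K \<subseteq> U}"
  shows "continuous_map X (Aut_topology G T) \<phi>"
  unfolding Aut_topology_def
proof (rule continuous_on_generated_topo)
  fix B assume "B \<in> {{f \<in> carrier (Aut G T). f ` K \<subseteq> U} | K U. compactin T K \<and> openin T U}"
  then obtain K U where KU: "compactin T K" "openin T U" "B = {f \<in> carrier (Aut G T). f ` K \<subseteq> U}"
    by auto
  then have "\<phi> -` B \<inter> topspace X = {z \<in> topspace X. \<phi> z ` K \<subseteq> U}"
    using assms(1) by auto
  then show "openin X (\<phi> -` B \<inter> topspace X)"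
    using assms(2) KU by simp
next
  show "\<phi> ` topspace X \<subseteq> \<Union>{{f \<in> carrier (Aut G T). f ` K \<subseteq> U} | K U. compactin T K \<and> openin T U}"
    using topspace_Aut_topology assms(1) unfolding Aut_topology_def by auto
qed

text \<open>Continuity into the compact-open topology follows from joint continuity, by the tube lemma.\<close>
lemma continuous_map_curry_Aut:
  assumes "\<And>z. z \<in> topspace X \<Longrightarrow> \<phi> z \<in> carrier (Aut G T)"
    and cont: "continuous_map (prod_topology X T) T (\<lambda>p. \<phi> (fst p) (snd p))"
  shows "continuous_map X (Aut_topology G T) \<phi>"
proof (rule continuous_map_into_AutI)
  fix K U assume KU: "compactin T K" "openin T U"
  define W where "W = {p \<in> topspace (prod_topology X T). \<phi> (fst p) (snd p) \<in> U}"
  have W: "openin (prod_topology X T) W"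
    unfolding W_def using cont KU(2) by (rule openin_continuous_map_preimage)
  have KG: "K \<subseteq> topspace T"
    using KU(1) compactin_subset_topspace by auto
  show "openin X {z \<in> topspace X. \<phi> z ` K \<subseteq> U}"
  proof (subst openin_subopen, intro ballI)
    fix z assume z: "z \<in> {z \<in> topspace X. \<phi> z ` K \<subseteq> U}"
    then have "{z} \<times> K \<subseteq> W"
      using KG by (auto simp: W_def)
    then obtain A B where "openin X A" "openin T B" "{z} \<subseteq> A" "K \<subseteq> B" "A \<times> B \<subseteq> W"
      using Wallace_theorem_prod_topology[OF _ KU(1) W, of "{z}"] z by auto
    moreover have "A \<subseteq> {z \<in> topspace X. \<phi> z ` K \<subseteq> U}"
    proof
      fix z' assume "z' \<in> A"
      then have "(z', y) \<in> W" if "y \<in> K" for y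
        using calculation(4,5) that by blast
      then show "z' \<in> {z \<in> topspace X. \<phi> z ` K \<subseteq> U}"
        using \<open>z' \<in> A\<close> openin_subset[OF calculation(1)] by (auto simp: W_def)
    qed
    ultimately show "\<exists>A. openin X A \<and> z \<in> A \<and> A \<subseteq> {z \<in> topspace X. \<phi> z ` K \<subseteq> U}"
      by blast
  qed
qed (use assms in auto)

end

locale compact_topological_group = topological_group +
  assumes compact: "compact_space T"
begin

text \<open>Joint continuity of the evaluation map uses that every point of a compact Hausdorff space has
  a neighbourhood base of compact sets.\<close>
lemma continuous_map_eval: "continuous_map (prod_topology (Aut_topology G T) T) T (\<lambda>p. fst p (snd p))"
proof (rule continuous_map_prodI)
  fix f x W assume W: "openin T W" and f: "f \<in> topspace (Aut_topology G T)" and x: "x \<in> topspace T"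
    and fx: "fst (f, x) (snd (f, x)) \<in> W"
  have fA: "f \<in> carrier (Aut G T)"
    using f topspace_Aut_topology by simp
  have "openin T {y \<in> carrier G. f y \<in> W}"
    using Aut_continuous[OF fA] W by (rule openin_preimage)
  moreover have "x \<in> {y \<in> carrier G. f y \<in> W}"
    using x fx topspace_eq_carrier by simp
  moreover have "neighbourhood_base_of (closedin T) T"
    using compact_Hausdorff_imp_regular_space[OF compact Hausdorff] neighbourhood_base_of_closedin by auto
  ultimately obtain V C where VC: "openin T V" "closedin T C" "x \<in> V" "V \<subseteq> C" "C \<subseteq> {y \<in> carrier G. f y \<in> W}"
    unfolding neighbourhood_base_of by meson
  have "openin (Aut_topology G T) {f \<in> carrier (Aut G T). f ` C \<subseteq> W}"
    using VC(2) compact W by (intro openin_Aut_topology_basic closedin_compact_space)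
  then show "\<exists>A B. openin (Aut_topology G T) A \<and> openin T B \<and> f \<in> A \<and> x \<in> B \<and>
      (\<forall>g\<in>A. \<forall>y\<in>B. fst (g, y) (snd (g, y)) \<in> W)"
    using VC fA by (intro exI[of _ "{f \<in> carrier (Aut G T). f ` C \<subseteq> W}"] exI[of _ V]) auto
qed (simp add: topspace_Aut_topology topspace_eq_carrier Aut_closed)

lemma continuous_map_Aut_apply:
  assumes "continuous_map X (Aut_topology G T) \<phi>" "continuous_map X T g"
  shows "continuous_map X T (\<lambda>z. \<phi> z (g z))"
  using continuous_map_compose[OF _ continuous_map_eval, of X "\<lambda>z. (\<phi> z, g z)"] assms
  by (simp add: o_def continuous_map_paired)

text \<open>For the inverse, the condition \<open>inv f ` K \<subseteq> U\<close> is equivalent to \<open>f\<close> mapping the complement of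
  \<open>U\<close>, which is compact, into the complement of \<open>K\<close>, which is open.\<close>
lemma topological_group_Aut: "topological_group (Aut G T) (Aut_topology G T)"
proof (intro topological_group.intro topological_group_axioms.intro)
  show "group (Aut G T)" "topspace (Aut_topology G T) = carrier (Aut G T)"
    by (rule group_Aut, rule topspace_Aut_topology)
  show "Hausdorff_space (Aut_topology G T)"
    unfolding Hausdorff_space_def topspace_Aut_topology
  proof (intro allI impI, elim conjE)
    fix f g assume fg: "f \<in> carrier (Aut G T)" "g \<in> carrier (Aut G T)" "f \<noteq> g"
    then obtain x where x: "x \<in> carrier G" "f x \<noteq> g x"
      using Aut_eqI by blast
    then obtain U V where UV: "openin T U" "openin T V" "f x \<in> U" "g x \<in> V" "disjnt U V"
      using Hausdorff Aut_closed fg unfolding Hausdorff_space_def topspace_eq_carrier by meson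
    have "compactin T {x}"
      using x by (simp add: topspace_eq_carrier)
    then have "openin (Aut_topology G T) {f \<in> carrier (Aut G T). f ` {x} \<subseteq> U}"
      "openin (Aut_topology G T) {f \<in> carrier (Aut G T). f ` {x} \<subseteq> V}"
      using UV by (auto intro: openin_Aut_topology_basic simp del: image_insert)
    moreover have "disjnt {f \<in> carrier (Aut G T). f ` {x} \<subseteq> U} {f \<in> carrier (Aut G T). f ` {x} \<subseteq> V}"
      using UV(5) by (auto simp: disjnt_iff)
    moreover have "f \<in> {f \<in> carrier (Aut G T). f ` {x} \<subseteq> U}" "g \<in> {f \<in> carrier (Aut G T). f ` {x} \<subseteq> V}"
      using fg UV by auto
    ultimately show "\<exists>U V. openin (Aut_topology G T) U \<and> openin (Aut_topology G T) V \<and>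
        f \<in> U \<and> g \<in> V \<and> disjnt U V"
      by meson
  qed
  show "continuous_map (prod_topology (Aut_topology G T) (Aut_topology G T)) (Aut_topology G T)
      (\<lambda>(f, g). f \<otimes>\<^bsub>Aut G T\<^esub> g)" (is "continuous_map ?X _ _")
  proof (rule continuous_map_curry_Aut)
    have "continuous_map (prod_topology ?X T) T (\<lambda>p. fst (fst p) (snd (fst p) (snd p)))"
      by (rule continuous_map_Aut_apply
          [OF continuous_map_compose[OF continuous_map_fst continuous_map_fst, unfolded o_def]
            continuous_map_Aut_apply
              [OF continuous_map_compose[OF continuous_map_fst continuous_map_snd, unfolded o_def]
                continuous_map_snd]])
    then show "continuous_map (prod_topology ?X T) T
        (\<lambda>p. (case fst p of (f, g) \<Rightarrow> f \<otimes>\<^bsub>Aut G T\<^esub> g) (snd p))"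
      by (rule continuous_map_eq) (auto simp: topspace_Aut_topology topspace_eq_carrier Aut_mult_apply)
  qed (auto simp: topspace_Aut_topology)
  show "continuous_map (Aut_topology G T) (Aut_topology G T) (\<lambda>f. inv\<^bsub>Aut G T\<^esub> f)"
  proof (rule continuous_map_into_AutI)
    fix K U assume KU: "compactin T K" "openin T U"
    have KG: "K \<subseteq> carrier G" and UG: "U \<subseteq> carrier G"
      using compactin_subset_topspace[OF KU(1)] open_subset_carrier[OF KU(2)] topspace_eq_carrier
      by auto
    have "compactin T (carrier G - U)"
      using KU(2) by (intro closedin_compact_space compact) (metis closedin_diff closedin_topspace topspace_eq_carrier)
    moreover have "openin T (carrier G - K)"
      using compactin_imp_closedin[OF Hausdorff KU(1)] by (metis openin_diff openin_topspace topspace_eq_carrier)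
    ultimately have "openin (Aut_topology G T) {f \<in> carrier (Aut G T). f ` (carrier G - U) \<subseteq> carrier G - K}"
      by (rule openin_Aut_topology_basic)
    moreover have "(inv\<^bsub>Aut G T\<^esub> f) ` K \<subseteq> U \<longleftrightarrow> f ` (carrier G - U) \<subseteq> carrier G - K"
      if f: "f \<in> carrier (Aut G T)" for f
    proof
      assume *: "(inv\<^bsub>Aut G T\<^esub> f) ` K \<subseteq> U"
      show "f ` (carrier G - U) \<subseteq> carrier G - K"
        using * Aut_inv_apply[OF f] Aut_closed[OF f] by force
    next
      assume *: "f ` (carrier G - U) \<subseteq> carrier G - K"
      show "(inv\<^bsub>Aut G T\<^esub> f) ` K \<subseteq> U"
      proof (intro image_subsetI, rule ccontr)
        fix k assume k: "k \<in> K" "(inv\<^bsub>Aut G T\<^esub> f) k \<notin> U"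
        then have "f ((inv\<^bsub>Aut G T\<^esub> f) k) \<in> carrier G - K"
          using * KG Aut_closed[OF Aut.inv_closed[OF f]] by blast
        then show False
          using k KG Aut_inv_apply[OF f] by auto
      qed
    qed
    ultimately show "openin (Aut_topology G T) {f \<in> topspace (Aut_topology G T). (inv\<^bsub>Aut G T\<^esub> f) ` K \<subseteq> U}"
      by (simp add: topspace_Aut_topology cong: conj_cong)
  qed (simp add: topspace_Aut_topology)
qed

sublocale Aut: topological_group "Aut G T" "Aut_topology G T"
  by (rule topological_group_Aut)

end

section \<open>The holomorph and its antidiagonal\<close>

lemma (in group) conjugate_eqI:
  assumes "a \<in> carrier G" "c \<in> carrier G" "a \<otimes> b = c \<otimes> a"
  shows "a \<otimes> b \<otimes> inv a = c"
  using assms by (simp add: m_assoc)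

lemma semidirect_simps [simp]:
  "carrier (semidirect G T P) = carrier G \<times> P"
  "(x, f) \<otimes>\<^bsub>semidirect G T P\<^esub> (y, g) = (x \<otimes>\<^bsub>G\<^esub> f y, f \<otimes>\<^bsub>Aut G T\<^esub> g)"
  "\<one>\<^bsub>semidirect G T P\<^esub> = (\<one>\<^bsub>G\<^esub>, \<one>\<^bsub>Aut G T\<^esub>)"
  by (simp_all add: semidirect_def)

lemma semidirect_carrier_update:
  "(semidirect G T Q)\<lparr>carrier := carrier G \<times> P\<rparr> = semidirect G T P"
  by (simp add: semidirect_def)

lemma semidirect_topology_subtopology:
  assumes "P \<subseteq> Q"
  shows "subtopology (semidirect_topology G T Q) (carrier G \<times> P) =
    prod_topology (subtopology T (carrier G)) (subtopology (Aut_topology G T) P)"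
  using assms by (simp add: semidirect_topology_def subtopology_Times subtopology_subtopology Int_absorb1)

context topological_group
begin

lemma inner_aut_apply: "x \<in> carrier G \<Longrightarrow> inner_aut G g x = g \<otimes> x \<otimes> inv g"
  by (simp add: inner_aut_def)

lemma homeomorphic_maps_inner_aut:
  assumes "g \<in> carrier G"
  shows "homeomorphic_maps T T (inner_aut G g) (inner_aut G (inv g))"
proof -
  have cont: "continuous_map T T (inner_aut G h)" if "h \<in> carrier G" for h
  proof (rule continuous_map_eq)
    show "continuous_map T T (\<lambda>x. h \<otimes> x \<otimes> inv h)"
      using that by (intro group_continuous_intros) auto
  qed (simp add: inner_aut_apply topspace_eq_carrier)
  show ?thesis
    unfolding homeomorphic_maps_def topspace_eq_carrier
    using assms cont by (simp add: inner_aut_apply m_assoc inv_mult_cancel mult_inv_cancel)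
qed

lemma inner_aut_in_Aut:
  assumes "g \<in> carrier G"
  shows "inner_aut G g \<in> carrier (Aut G T)"
  unfolding in_Aut_iff
proof (intro conjI)
  show homeo: "homeomorphic_map T T (inner_aut G g)"
    using homeomorphic_maps_inner_aut[OF assms] homeomorphic_map_maps[of T T] by auto
  show "inner_aut G g \<in> hom G G"
    using assms by (auto simp: hom_def inner_aut_apply m_assoc inv_mult_cancel)
  show "inner_aut G g \<in> extensional (carrier G)"
    by (simp add: inner_aut_def)
  show "bij_betw (inner_aut G g) (carrier G) (carrier G)"
    using homeo by (auto simp: homeomorphic_eq_everything_map bij_betw_def topspace_eq_carrier)
qed

lemma inner_aut_mult:
  assumes "g \<in> carrier G" "h \<in> carrier G"
  shows "inner_aut G (g \<otimes> h) = inner_aut G g \<otimes>\<^bsub>Aut G T\<^esub> inner_aut G h"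
  using assms
  by (intro Aut_eqI Aut.m_closed inner_aut_in_Aut)
    (auto simp: Aut_mult_apply inner_aut_in_Aut inner_aut_apply m_assoc inv_mult_group)

lemma inner_aut_one: "inner_aut G \<one> = \<one>\<^bsub>Aut G T\<^esub>"
  by (intro Aut_eqI inner_aut_in_Aut) (auto simp: inner_aut_apply Aut_one_apply)

lemma Aut_mult_inner_aut:
  assumes "f \<in> carrier (Aut G T)" "g \<in> carrier G"
  shows "f \<otimes>\<^bsub>Aut G T\<^esub> inner_aut G g = inner_aut G (f g) \<otimes>\<^bsub>Aut G T\<^esub> f"
  using assms
  by (intro Aut_eqI Aut.m_closed inner_aut_in_Aut)
    (auto simp: Aut_mult_apply inner_aut_in_Aut inner_aut_apply Aut_closed Aut_hom Aut_apply_inv)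

lemma inner_aut_eq_one_iff:
  assumes "g \<in> carrier G"
  shows "inner_aut G g = \<one>\<^bsub>Aut G T\<^esub> \<longleftrightarrow> g \<in> center G"
proof
  assume *: "inner_aut G g = \<one>\<^bsub>Aut G T\<^esub>"
  have "g \<otimes> x = x \<otimes> g" if x: "x \<in> carrier G" for x
  proof -
    have "g \<otimes> x \<otimes> inv g = x"
      using * Aut_one_apply[OF x] inner_aut_apply[OF x, of g] by simp
    then show ?thesis
      using assms x by (metis inv_solve_right' m_closed)
  qed
  then show "g \<in> center G"
    using assms by (simp add: center_def)
next
  assume "g \<in> center G"
  then have "g \<otimes> x \<otimes> inv g = x" if "x \<in> carrier G" for x
    using that assms by (intro conjugate_eqI) (auto simp: center_def)
  then show "inner_aut G g = \<one>\<^bsub>Aut G T\<^esub>"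
    using assms by (intro Aut_eqI inner_aut_in_Aut) (auto simp: inner_aut_apply Aut_one_apply)
qed

text \<open>In the holomorph this is the product of \<open>inv h\<close> and the conjugation by \<open>h\<close>. These
  elements act trivially on \<open>G\<close> by conjugation, and they form the centraliser of \<open>G\<close>, a second
  copy of \<open>G\<close>.\<close>
definition antidiagonal :: "'a \<Rightarrow> 'a \<times> ('a \<Rightarrow> 'a)" where
  "antidiagonal h = (inv h, inner_aut G h)"

text \<open>The automorphism of \<open>G\<close> that conjugation by \<open>p\<close> in the holomorph induces on the normal
  subgroup \<open>G\<close>.\<close>
definition holomorph_action :: "'a \<times> ('a \<Rightarrow> 'a) \<Rightarrow> 'a \<Rightarrow> 'a" where
  "holomorph_action p = inner_aut G (fst p) \<otimes>\<^bsub>Aut G T\<^esub> snd p"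

abbreviation holomorph where "holomorph \<equiv> semidirect G T (carrier (Aut G T))"

lemma group_holomorph: "group holomorph"
proof (rule groupI)
  show "\<exists>q\<in>carrier holomorph. q \<otimes>\<^bsub>holomorph\<^esub> p = \<one>\<^bsub>holomorph\<^esub>" if p: "p \<in> carrier holomorph" for p
  proof -
    obtain x f where xf: "p = (x, f)" "x \<in> carrier G" "f \<in> carrier (Aut G T)"
      using p by auto
    let ?g = "inv\<^bsub>Aut G T\<^esub> f"
    have "(?g (inv x), ?g) \<otimes>\<^bsub>holomorph\<^esub> p = \<one>\<^bsub>holomorph\<^esub>"
      using xf Aut.inv_closed[OF xf(3)] by (simp add: Aut_apply_inv Aut_closed)
    then show ?thesis
      using xf Aut.inv_closed[OF xf(3)] Aut_closed by (intro bexI[of _ "(?g (inv x), ?g)"]) auto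
  qed
qed (auto simp: Aut_closed Aut_hom Aut_mult_apply Aut_one_apply m_assoc Aut.m_assoc)

lemma holomorph_inv:
  assumes "x \<in> carrier G" "f \<in> carrier (Aut G T)"
  shows "inv\<^bsub>holomorph\<^esub> (x, f) = ((inv\<^bsub>Aut G T\<^esub> f) (inv x), inv\<^bsub>Aut G T\<^esub> f)"
  using assms Aut.inv_closed[OF assms(2)]
  by (intro group.inv_equality[OF group_holomorph]) (auto simp: Aut_apply_inv Aut_closed)

lemma antidiagonal_closed: "h \<in> carrier G \<Longrightarrow> antidiagonal h \<in> carrier holomorph"
  by (simp add: antidiagonal_def inner_aut_in_Aut)

lemma antidiagonal_one: "antidiagonal \<one> = \<one>\<^bsub>holomorph\<^esub>"
  by (simp add: antidiagonal_def inner_aut_one)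

lemma antidiagonal_eq_one_iff: "h \<in> carrier G \<Longrightarrow> antidiagonal h = \<one>\<^bsub>holomorph\<^esub> \<longleftrightarrow> h = \<one>"
  using antidiagonal_one by (auto simp: antidiagonal_def)

lemma antidiagonal_hom: "antidiagonal \<in> hom G holomorph"
  by (auto simp: hom_def antidiagonal_def inner_aut_in_Aut inner_aut_apply inner_aut_mult
      inv_mult_group m_assoc inv_mult_cancel mult_inv_cancel)

text \<open>Conjugation by \<open>(x, f)\<close> acts on the antidiagonal through \<open>f\<close> alone, because antidiagonal
  elements commute with \<open>G\<close>. The form without inverses can be used in every subgroup of the
  holomorph.\<close>
lemma holomorph_mult_antidiagonal:
  assumes "x \<in> carrier G" "f \<in> carrier (Aut G T)" "h \<in> carrier G"
  shows "(x, f) \<otimes>\<^bsub>holomorph\<^esub> antidiagonal h = antidiagonal (f h) \<otimes>\<^bsub>holomorph\<^esub> (x, f)"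
  using assms
  by (simp add: antidiagonal_def Aut_mult_inner_aut inner_aut_apply Aut_apply_inv Aut_closed
      m_assoc inv_mult_cancel)

lemma holomorph_action_closed:
  "p \<in> carrier holomorph \<Longrightarrow> holomorph_action p \<in> carrier (Aut G T)"
  by (auto simp: holomorph_action_def inner_aut_in_Aut)

lemma holomorph_mult_left_factor:
  assumes "p \<in> carrier holomorph" "y \<in> carrier G"
  shows "p \<otimes>\<^bsub>holomorph\<^esub> (y, \<one>\<^bsub>Aut G T\<^esub>) = (holomorph_action p y, \<one>\<^bsub>Aut G T\<^esub>) \<otimes>\<^bsub>holomorph\<^esub> p"
  using assms
  by (auto simp: holomorph_action_def Aut_mult_apply inner_aut_in_Aut inner_aut_apply Aut_one_apply
      Aut_closed m_assoc)

text \<open>An element \<open>(x, f)\<close> of the holomorph is determined by \<open>x\<close> and by its action on \<open>G\<close>.\<close>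
lemma eq_inner_aut_inv_mult_holomorph_action:
  assumes "x \<in> carrier G" "f \<in> carrier (Aut G T)"
  shows "inner_aut G (inv x) \<otimes>\<^bsub>Aut G T\<^esub> holomorph_action (x, f) = f"
proof -
  have "inner_aut G (inv x) \<otimes>\<^bsub>Aut G T\<^esub> holomorph_action (x, f) =
      inner_aut G (inv x) \<otimes>\<^bsub>Aut G T\<^esub> inner_aut G x \<otimes>\<^bsub>Aut G T\<^esub> f"
    unfolding holomorph_action_def using assms by (simp add: inner_aut_in_Aut Aut.m_assoc)
  also have "\<dots> = inner_aut G (inv x \<otimes> x) \<otimes>\<^bsub>Aut G T\<^esub> f"
    using assms by (simp only: inner_aut_mult inv_closed)
  finally show ?thesis
    using assms by (simp add: inner_aut_one)
qed

text \<open>The kernel of the action consists of antidiagonal elements.\<close>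
lemma holomorph_action_eq_oneD:
  assumes "p \<in> carrier holomorph" "holomorph_action p = \<one>\<^bsub>Aut G T\<^esub>"
  shows "p = antidiagonal (inv (fst p))"
  using assms eq_inner_aut_inv_mult_holomorph_action[of "fst p" "snd p"]
  by (cases p) (auto simp: antidiagonal_def inner_aut_in_Aut)

lemma semidirect_topology_carrier:
  "semidirect_topology G T (carrier (Aut G T)) = prod_topology T (Aut_topology G T)"
  by (simp add: semidirect_topology_def topspace_Aut_topology[symmetric])

lemma subtopology_semidirect:
  assumes "P \<subseteq> Q"
  shows "subtopology (semidirect_topology G T Q) (carrier G \<times> P) = semidirect_topology G T P"
  using semidirect_topology_subtopology[OF assms, of G T]
  by (simp add: semidirect_topology_def topspace_eq_carrier[symmetric])

lemma subgroup_semidirect: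
  assumes "subgroup P (Aut G T)"
  shows "subgroup (carrier G \<times> P) holomorph"
proof -
  interpret P: subgroup P "Aut G T" by (rule assms)
  interpret hol: group holomorph by (rule group_holomorph)
  show ?thesis
  proof (rule hol.subgroupI)
    show "carrier G \<times> P \<subseteq> carrier holomorph"
      using P.subset by auto
    show "carrier G \<times> P \<noteq> {}"
      using P.one_closed one_closed by blast
  next
    fix a assume "a \<in> carrier G \<times> P"
    then obtain x f where xf: "a = (x, f)" "x \<in> carrier G" "f \<in> P" "f \<in> carrier (Aut G T)"
      using P.subset by auto
    then show "inv\<^bsub>holomorph\<^esub> a \<in> carrier G \<times> P"
      using holomorph_inv[OF xf(2,4)] P.m_inv_closed[OF xf(3)] Aut_closed[OF Aut.inv_closed[OF xf(4)]] by simp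
  next
    fix a b assume "a \<in> carrier G \<times> P" "b \<in> carrier G \<times> P"
    then show "a \<otimes>\<^bsub>holomorph\<^esub> b \<in> carrier G \<times> P"
      using P.subset by (auto simp: Aut_closed subset_iff)
  qed
qed

end

context compact_topological_group
begin

abbreviation holomorph_topology where "holomorph_topology \<equiv> prod_topology T (Aut_topology G T)"

lemma continuous_map_inner_aut:
  assumes "continuous_map X T g"
  shows "continuous_map X (Aut_topology G T) (\<lambda>z. inner_aut G (g z))"
proof (rule continuous_map_curry_Aut)
  have g: "g z \<in> carrier G" if "z \<in> topspace X" for z
    using assms that by (auto simp: continuous_map_def topspace_eq_carrier)
  then show "inner_aut G (g z) \<in> carrier (Aut G T)" if "z \<in> topspace X" for z
    using that inner_aut_in_Aut by simp
  have gfst: "continuous_map (prod_topology X T) T (\<lambda>p. g (fst p))"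
    using continuous_map_compose[OF continuous_map_fst assms] by (simp add: o_def)
  show "continuous_map (prod_topology X T) T (\<lambda>p. inner_aut G (g (fst p)) (snd p))"
  proof (rule continuous_map_eq)
    show "continuous_map (prod_topology X T) T (\<lambda>p. g (fst p) \<otimes> snd p \<otimes> inv (g (fst p)))"
      by (intro continuous_map_mult continuous_map_inv gfst continuous_map_snd)
  qed (auto simp: inner_aut_apply topspace_eq_carrier)
qed

lemma topological_group_holomorph: "topological_group holomorph holomorph_topology"
proof (intro topological_group.intro topological_group_axioms.intro)
  show "group holomorph"
    by (rule group_holomorph)
  show "topspace holomorph_topology = carrier holomorph"
    by (simp add: topspace_eq_carrier topspace_Aut_topology)
  show "Hausdorff_space holomorph_topology"
    using Hausdorff Aut.Hausdorff by (simp add: Hausdorff_space_prod_topology)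
  let ?X = "prod_topology holomorph_topology holomorph_topology"
  have proj: "continuous_map ?X T (\<lambda>r. fst (fst r))" "continuous_map ?X (Aut_topology G T) (\<lambda>r. snd (fst r))"
    "continuous_map ?X T (\<lambda>r. fst (snd r))" "continuous_map ?X (Aut_topology G T) (\<lambda>r. snd (snd r))"
    by (rule continuous_map_compose[OF continuous_map_fst continuous_map_fst, unfolded o_def]
        continuous_map_compose[OF continuous_map_fst continuous_map_snd, unfolded o_def]
        continuous_map_compose[OF continuous_map_snd continuous_map_fst, unfolded o_def]
        continuous_map_compose[OF continuous_map_snd continuous_map_snd, unfolded o_def])+
  have "continuous_map ?X holomorph_topology (\<lambda>r. (fst (fst r) \<otimes> (snd (fst r)) (fst (snd r)),
      snd (fst r) \<otimes>\<^bsub>Aut G T\<^esub> snd (snd r)))"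
    unfolding continuous_map_paired
    by (intro conjI continuous_map_mult Aut.continuous_map_mult proj
        continuous_map_Aut_apply[OF proj(2,3)])
  then show "continuous_map ?X holomorph_topology (\<lambda>(p, q). p \<otimes>\<^bsub>holomorph\<^esub> q)"
    by (rule continuous_map_eq) auto
  have inv: "continuous_map holomorph_topology T (\<lambda>p. inv (fst p))"
    "continuous_map holomorph_topology (Aut_topology G T) (\<lambda>p. inv\<^bsub>Aut G T\<^esub> (snd p))"
    by (rule continuous_map_inv[OF continuous_map_fst] Aut.continuous_map_inv[OF continuous_map_snd])+
  have "continuous_map holomorph_topology holomorph_topology
      (\<lambda>p. ((inv\<^bsub>Aut G T\<^esub> (snd p)) (inv (fst p)), inv\<^bsub>Aut G T\<^esub> (snd p)))"
    unfolding continuous_map_paired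
    by (intro conjI continuous_map_Aut_apply[OF inv(2,1)] inv(2))
  then show "continuous_map holomorph_topology holomorph_topology (\<lambda>p. inv\<^bsub>holomorph\<^esub> p)"
  proof (rule continuous_map_eq)
    fix p assume "p \<in> topspace holomorph_topology"
    then obtain x f where xf: "p = (x, f)" "x \<in> carrier G" "f \<in> carrier (Aut G T)"
      by (auto simp: topspace_eq_carrier topspace_Aut_topology)
    then show "((inv\<^bsub>Aut G T\<^esub> (snd p)) (inv (fst p)), inv\<^bsub>Aut G T\<^esub> (snd p)) = inv\<^bsub>holomorph\<^esub> p"
      using holomorph_inv[of x f] by simp
  qed
qed

sublocale holomorph: topological_group holomorph holomorph_topology
  by (rule topological_group_holomorph)

lemma topological_group_semidirect:
  assumes "subgroup P (Aut G T)"
  shows "topological_group (semidirect G T P) (semidirect_topology G T P)"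
  using holomorph.topological_group_subgroup[OF subgroup_semidirect[OF assms]]
    subtopology_semidirect[OF subgroup.subset[OF assms]]
  by (simp add: semidirect_carrier_update semidirect_topology_carrier)

lemma continuous_map_antidiagonal: "continuous_map T holomorph_topology antidiagonal"
  unfolding antidiagonal_def continuous_map_paired
  by (intro conjI continuous_inv continuous_map_inner_aut) simp

lemma continuous_map_holomorph_action:
  "continuous_map holomorph_topology (Aut_topology G T) holomorph_action"
  unfolding holomorph_action_def
  by (intro Aut.continuous_map_mult continuous_map_inner_aut continuous_map_fst continuous_map_snd)

section \<open>Non-minimality and subgroups of the compact group\<close>

text \<open>Write \<open>S(P)\<close> for the semidirect product of \<open>G\<close> and \<open>P\<close>. The antidiagonal copy of \<open>H\<close> is a
  normal subgroup of \<open>S(Q)\<close>, where \<open>Q\<close> is the stabiliser of \<open>H\<close> in \<open>Aut(G)\<close>. It is compact, hence closed. It meets \<open>S(P)\<close> trivially because only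
  central elements of \<open>G\<close> induce the trivial automorphism, and it lies in the closure of
  \<open>S(P)\<close> because the inner automorphisms by elements of \<open>H\<close> lie in the closure of \<open>P\<close>.\<close>
theorem not_minimal_if_subgroup:
  assumes P: "subgroup P (Aut G T)" and H: "subgroup H G" and closed: "closedin T H"
    and nontriv: "H \<noteq> {\<one>}" and center: "H \<inter> center G = {\<one>}"
    and inv: "\<And>f. f \<in> P \<Longrightarrow> f ` H \<subseteq> H"
    and dense: "inner_aut G ` H \<subseteq> Aut_topology G T closure_of P"
    and inter: "inner_aut G ` H \<inter> P = {\<one>\<^bsub>Aut G T\<^esub>}"
  shows "\<not> minimal_topological_group (semidirect G T P) (semidirect_topology G T P)"
proof -
  interpret P: subgroup P "Aut G T" by (rule P)
  interpret H: subgroup H G by (rule H)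
  define Q where "Q = {f \<in> carrier (Aut G T). f ` H = H}"
  have image_inv: "(inv\<^bsub>Aut G T\<^esub> f) ` f ` H = H" if "f \<in> carrier (Aut G T)" for f
    using Aut_inv_apply(1)[OF that] H.subset by (force simp: image_image)
  have image_eq: "f ` H = H"
    if f: "f \<in> carrier (Aut G T)" "f ` H \<subseteq> H" "(inv\<^bsub>Aut G T\<^esub> f) ` H \<subseteq> H" for f
  proof
    have "H = f ` (inv\<^bsub>Aut G T\<^esub> f) ` H"
      using image_inv[OF Aut.inv_closed[OF f(1)]] f(1) by simp
    then show "H \<subseteq> f ` H"
      using f(3) by blast
  qed (rule f(2))
  have Q: "subgroup Q (Aut G T)"
  proof (rule Aut.subgroupI)
    show "Q \<subseteq> carrier (Aut G T)"
      by (auto simp: Q_def)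
    have "\<one>\<^bsub>Aut G T\<^esub> ` H = H"
      using Aut_one_apply H.subset by force
    then show "Q \<noteq> {}"
      by (auto simp: Q_def)
    show "inv\<^bsub>Aut G T\<^esub> f \<in> Q" if "f \<in> Q" for f
      using that image_inv[of f] by (simp add: Q_def)
    show "f \<otimes>\<^bsub>Aut G T\<^esub> g \<in> Q" if "f \<in> Q" "g \<in> Q" for f g
    proof -
      have fg: "f \<in> carrier (Aut G T)" "g \<in> carrier (Aut G T)" "f ` H = H" "g ` H = H"
        using that by (auto simp: Q_def)
      have "(f \<otimes>\<^bsub>Aut G T\<^esub> g) ` H = f ` g ` H"
        unfolding image_image using H.subset by (intro image_cong) (auto simp: Aut_mult_apply[OF fg(1,2)])
      then show ?thesis
        using fg by (simp add: Q_def)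
    qed
  qed
  have PQ: "P \<subseteq> Q"
  proof
    fix f assume f: "f \<in> P"
    then have "f \<in> carrier (Aut G T)"
      using P.subset by auto
    then show "f \<in> Q"
      using image_eq inv[OF f] inv[OF P.m_inv_closed[OF f]] by (simp add: Q_def)
  qed
  have inner_Q: "inner_aut G h \<in> Q" if h: "h \<in> H" for h
  proof -
    have sub: "inner_aut G k ` H \<subseteq> H" if "k \<in> H" for k
      using that H.subset by (auto simp: inner_aut_apply)
    have "inv\<^bsub>Aut G T\<^esub> (inner_aut G h) = inner_aut G (inv h)"
      using h inner_aut_mult[of "inv h" h]
      by (intro Aut.inv_equality) (auto simp: inner_aut_in_Aut inner_aut_one)
    then have "inner_aut G h ` H = H"
      using h sub by (intro image_eq) (auto simp: inner_aut_in_Aut)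
    then show ?thesis
      using h by (simp add: Q_def inner_aut_in_Aut)
  qed
  let ?S = "semidirect G T Q" and ?TS = "semidirect_topology G T Q"
  interpret S: topological_group ?S ?TS
    using Q by (rule topological_group_semidirect)
  have TS: "?TS = subtopology holomorph_topology (carrier G \<times> Q)"
    using subtopology_semidirect[OF subgroup.subset[OF Q]] by (simp add: semidirect_topology_carrier)
  have N_sub: "antidiagonal ` H \<subseteq> carrier G \<times> Q"
    using inner_Q by (auto simp: antidiagonal_def)
  have "subgroup (antidiagonal ` H) holomorph"
    using group_hom.subgroup_img_is_subgroup[OF _ H, of holomorph antidiagonal] antidiagonal_hom
    by (simp add: group_hom_def group_hom_axioms_def group_holomorph is_group)
  then have "subgroup (antidiagonal ` H) ?S"
    using holomorph.subgroup_incl[OF _ subgroup_semidirect[OF Q] N_sub]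
    by (simp add: semidirect_carrier_update)
  then have normal: "antidiagonal ` H \<lhd> ?S"
  proof (rule S.normal_invI)
    fix p n assume p: "p \<in> carrier ?S" and n: "n \<in> antidiagonal ` H"
    obtain x f where xf: "p = (x, f)" "x \<in> carrier G" "f \<in> carrier (Aut G T)" "f ` H = H"
      using p by (auto simp: Q_def)
    obtain h where h: "n = antidiagonal h" "h \<in> H"
      using n by auto
    have fh: "f h \<in> H"
      using xf(4) h(2) by auto
    have "p \<otimes>\<^bsub>?S\<^esub> n = antidiagonal (f h) \<otimes>\<^bsub>?S\<^esub> p"
      using holomorph_mult_antidiagonal[OF xf(2,3), of h] h xf(1)
      by (simp add: antidiagonal_def)
    then have "p \<otimes>\<^bsub>?S\<^esub> n \<otimes>\<^bsub>?S\<^esub> inv\<^bsub>?S\<^esub> p = antidiagonal (f h)"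
      using p fh N_sub by (intro S.conjugate_eqI) auto
    then show "p \<otimes>\<^bsub>?S\<^esub> n \<otimes>\<^bsub>?S\<^esub> inv\<^bsub>?S\<^esub> p \<in> antidiagonal ` H"
      using fh by simp
  qed
  have "compactin holomorph_topology (antidiagonal ` H)"
    using closedin_compact_space[OF compact closed] continuous_map_antidiagonal by (rule image_compactin)
  then have "compactin ?TS (antidiagonal ` H)"
    using N_sub by (simp add: TS compactin_subtopology)
  then have closed_N: "closedin ?TS (antidiagonal ` H)"
    using S.Hausdorff compactin_imp_closedin by blast
  have nontriv_N: "antidiagonal ` H \<noteq> {\<one>\<^bsub>?S\<^esub>}"
  proof -
    obtain h where "h \<in> H" "h \<noteq> \<one>"
      using nontriv H.one_closed by auto
    then show ?thesis
      using antidiagonal_eq_one_iff[of h] by auto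
  qed
  have inter_N: "antidiagonal ` H \<inter> (carrier G \<times> P) = {\<one>\<^bsub>?S\<^esub>}"
  proof (intro equalityI subsetI)
    fix n assume "n \<in> antidiagonal ` H \<inter> (carrier G \<times> P)"
    then obtain h where h: "h \<in> H" "n = antidiagonal h" "inner_aut G h \<in> P"
      by (auto simp: antidiagonal_def)
    then have "inner_aut G h = \<one>\<^bsub>Aut G T\<^esub>"
      using inter by blast
    then have "h = \<one>"
      using center h(1) inner_aut_eq_one_iff[of h] by auto
    then show "n \<in> {\<one>\<^bsub>?S\<^esub>}"
      using h(2) antidiagonal_one by simp
  next
    fix n assume "n \<in> {\<one>\<^bsub>?S\<^esub>}"
    then show "n \<in> antidiagonal ` H \<inter> (carrier G \<times> P)"
      using imageI[OF H.one_closed, of antidiagonal] antidiagonal_one by simp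
  qed
  have "antidiagonal h \<in> ?TS closure_of (carrier G \<times> P)" if h: "h \<in> H" for h
  proof -
    have "antidiagonal h \<in> holomorph_topology closure_of (carrier G \<times> P)"
      using dense h closure_of_topspace[of T]
      by (auto simp: closure_of_Times antidiagonal_def topspace_eq_carrier)
    moreover have "(carrier G \<times> Q) \<inter> (carrier G \<times> P) = carrier G \<times> P"
      using PQ by auto
    ultimately show ?thesis
      using N_sub h by (auto simp: TS closure_of_subtopology)
  qed
  then have dense_N: "antidiagonal ` H \<subseteq> ?TS closure_of (carrier G \<times> P)"
    by auto
  have "subgroup (carrier G \<times> P) ?S"
    using holomorph.subgroup_incl[OF subgroup_semidirect[OF P] subgroup_semidirect[OF Q]] PQ
    by (auto simp: semidirect_carrier_update)
  from S.not_minimal_if_normal_in_closure[OF this normal closed_N nontriv_N inter_N dense_N]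
  show ?thesis
    by (simp add: semidirect_carrier_update subtopology_semidirect[OF PQ])
qed

text \<open>Let \<open>T'\<close> be a strictly coarser Hausdorff group topology on the semidirect product. It agrees with \<open>T\<close> on the
  compact subgroup \<open>G\<close>, so conjugation on \<open>G\<close> is continuous for \<open>T'\<close>; this forces the elements
  of the core to act trivially on \<open>G\<close>, that is, to be antidiagonal. The subgroup \<open>H\<close> of all
  \<open>h\<close> with \<open>antidiagonal h\<close> in the core inherits its properties from the core. If it were
  trivial, compactness of \<open>G\<close> would make the \<open>T'\<close>-neighbourhoods of the identity converge to the
  identity in the original topology, and \<open>T'\<close> would not be strictly coarser.\<close>
theorem subgroup_if_not_minimal:
  assumes P: "subgroup P (Aut G T)"
    and not_min: "\<not> minimal_topological_group (semidirect G T P) (semidirect_topology G T P)"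
  shows "\<exists>H. subgroup H G \<and> closedin T H \<and> H \<noteq> {\<one>} \<and> H \<inter> center G = {\<one>} \<and>
    (\<forall>f \<in> P. f ` H \<subseteq> H) \<and> inner_aut G ` H \<subseteq> (Aut_topology G T) closure_of P \<and>
    inner_aut G ` H \<inter> P = {\<one>\<^bsub>Aut G T\<^esub>}"
proof -
  interpret P: subgroup P "Aut G T" by (rule P)
  let ?S = "semidirect G T P" and ?TS = "semidirect_topology G T P" and ?M = "carrier G \<times> P"
  have S_eq: "holomorph\<lparr>carrier := ?M\<rparr> = ?S"
    by (rule semidirect_carrier_update)
  have TS_eq: "subtopology holomorph_topology ?M = ?TS"
    using subtopology_semidirect[OF P.subset] by (simp add: semidirect_topology_carrier)
  interpret S: topological_group ?S ?TS
    using P by (rule topological_group_semidirect)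
  obtain T' where T': "topological_group ?S T'" "\<And>U. openin T' U \<Longrightarrow> openin ?TS U" "T' \<noteq> ?TS"
    using not_min S.topological_group_axioms unfolding minimal_topological_group_def by blast
  interpret M: coarser_subgroup_topology holomorph holomorph_topology ?M T'
  proof (intro coarser_subgroup_topology.intro coarser_subgroup_topology_axioms.intro)
    show "topological_group holomorph holomorph_topology"
      by (rule topological_group_holomorph)
    show "subgroup ?M holomorph"
      using P by (rule subgroup_semidirect)
    show "topological_group (holomorph\<lparr>carrier := ?M\<rparr>) T'"
      using T'(1) by (simp only: S_eq)
    show "openin (subtopology holomorph_topology ?M) U" if "openin T' U" for U
      using T'(2)[OF that] by (simp only: TS_eq)
  qed
  interpret T': topological_group ?S T' by (rule T'(1))
  have act_cont: "continuous_map T' (Aut_topology G T) holomorph_action"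
  proof (rule continuous_map_curry_Aut)
    show "holomorph_action p \<in> carrier (Aut G T)" if "p \<in> topspace T'" for p
      using that P.subset by (intro holomorph_action_closed) (auto simp: M.topspace_T')
    let ?\<iota> = "\<lambda>y. (y, \<one>\<^bsub>Aut G T\<^esub>)"
    have "continuous_map T holomorph_topology ?\<iota>"
      unfolding continuous_map_paired by (simp add: topspace_Aut_topology)
    then have "continuous_map T ?TS ?\<iota>"
      unfolding TS_eq[symmetric] continuous_map_in_subtopology
      by (auto simp: topspace_eq_carrier)
    moreover have "continuous_map ?TS T' (\<lambda>p. p)"
      unfolding continuous_map_def
      using T'(2) S.topspace_eq_carrier T'.topspace_eq_carrier
      by (auto simp: Collect_conj_eq Int_def[symmetric])
        (metis Collect_mem_eq Int_absorb1 T'.open_subset_carrier semidirect_simps(1))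
    ultimately have \<iota>: "continuous_map T T' ?\<iota>"
      using continuous_map_compose by (fastforce simp: o_def)
    \<comment> \<open>The two topologies agree on \<open>G\<close>: a continuous bijection from a compact space onto a Hausdorff
      space is a homeomorphism.\<close>
    have fst_cont: "continuous_map (subtopology T' (?\<iota> ` topspace T)) T fst"
      using compact T'.Hausdorff \<iota> by (rule continuous_inverse_map) auto
    let ?X = "prod_topology T' T"
    have eq: "fst p \<otimes>\<^bsub>?S\<^esub> ?\<iota> (snd p) \<otimes>\<^bsub>?S\<^esub> inv\<^bsub>?S\<^esub> (fst p) = ?\<iota> (holomorph_action (fst p) (snd p))"
      and act_closed: "holomorph_action (fst p) (snd p) \<in> carrier G"
      if p: "p \<in> topspace ?X" for p
    proof -
      obtain x f y where p: "p = ((x, f), y)" "x \<in> carrier G" "f \<in> P" "y \<in> carrier G"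
        using p by (auto simp: M.topspace_T' topspace_eq_carrier)
      then have xf: "(x, f) \<in> carrier holomorph"
        using P.subset by auto
      then show act: "holomorph_action (fst p) (snd p) \<in> carrier G"
        using p Aut_closed[OF holomorph_action_closed[OF xf]] by simp
      show "fst p \<otimes>\<^bsub>?S\<^esub> ?\<iota> (snd p) \<otimes>\<^bsub>?S\<^esub> inv\<^bsub>?S\<^esub> (fst p) = ?\<iota> (holomorph_action (fst p) (snd p))"
        using holomorph_mult_left_factor[OF xf p(4)] p act
        by (intro S.conjugate_eqI) auto
    qed
    have "continuous_map ?X T' (\<lambda>p. ?\<iota> (snd p))"
      using continuous_map_compose[OF continuous_map_snd \<iota>] by (simp add: o_def)
    then have "continuous_map ?X T' (\<lambda>p. fst p \<otimes>\<^bsub>?S\<^esub> ?\<iota> (snd p) \<otimes>\<^bsub>?S\<^esub> inv\<^bsub>?S\<^esub> (fst p))"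
      by (intro T'.continuous_map_mult T'.continuous_map_inv continuous_map_fst)
    then have "continuous_map ?X T' (\<lambda>p. ?\<iota> (holomorph_action (fst p) (snd p)))"
      by (rule continuous_map_eq) (rule eq)
    then have "continuous_map ?X (subtopology T' (?\<iota> ` topspace T))
        (\<lambda>p. ?\<iota> (holomorph_action (fst p) (snd p)))"
      using act_closed unfolding continuous_map_in_subtopology topspace_eq_carrier by blast
    from continuous_map_compose[OF this fst_cont]
    show "continuous_map ?X T (\<lambda>p. holomorph_action (fst p) (snd p))"
      by (simp add: o_def)
  qed
  define H where "H = {h \<in> carrier G. antidiagonal h \<in> M.core}"
  have core_antidiagonal: "\<exists>h\<in>H. p = antidiagonal h" if p: "p \<in> M.core" for p
  proof -
    have pc: "p \<in> carrier holomorph"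
      using p M.core_subset by auto
    have "holomorph_action p = \<one>\<^bsub>Aut G T\<^esub>"
    proof (rule ccontr)
      assume "holomorph_action p \<noteq> \<one>\<^bsub>Aut G T\<^esub>"
      then obtain C D where CD: "openin (Aut_topology G T) C" "openin (Aut_topology G T) D"
        "\<one>\<^bsub>Aut G T\<^esub> \<in> C" "holomorph_action p \<in> D" "disjnt C D"
        using Aut.Hausdorff holomorph_action_closed[OF pc] Aut.one_closed
        unfolding Hausdorff_space_def topspace_Aut_topology by metis
      let ?U = "{q \<in> topspace T'. holomorph_action q \<in> C}"
      let ?V = "{q \<in> topspace holomorph_topology. holomorph_action q \<in> D}"
      have "openin T' ?U"
        using act_cont CD(1) by (rule openin_continuous_map_preimage)
      moreover have "\<one>\<^bsub>holomorph\<^esub> \<in> ?U"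
        using CD(3) by (simp add: M.topspace_T' holomorph_action_def inner_aut_one)
      ultimately have "p \<in> holomorph_topology closure_of ?U"
        by (rule in_nhds_adherenceD[OF p])
      moreover have "openin holomorph_topology ?V"
        using continuous_map_holomorph_action CD(2) by (rule openin_continuous_map_preimage)
      moreover have "p \<in> ?V"
        using pc CD(4) holomorph.topspace_eq_carrier by simp
      ultimately have "\<exists>q. q \<in> ?U \<and> q \<in> ?V"
        by (auto simp only: in_closure_of)
      then show False
        using CD(5) by (auto simp: disjnt_iff)
    qed
    then have "p = antidiagonal (inv (fst p))"
      using pc holomorph_action_eq_oneD by simp
    moreover have "inv (fst p) \<in> carrier G"
      using pc by (auto simp: mem_Times_iff)
    ultimately show ?thesis
      using p by (metis (mono_tags, lifting) H_def mem_Collect_eq)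
  qed
  interpret anti: group_hom G holomorph antidiagonal
    by unfold_locales (rule antidiagonal_hom)
  interpret core: subgroup M.core holomorph
    by (rule M.subgroup_core)
  have subgroup_H: "subgroup H G"
  proof (rule subgroupI)
    show "H \<subseteq> carrier G"
      by (auto simp: H_def)
    show "H \<noteq> {}"
      using core.one_closed antidiagonal_one by (auto simp: H_def)
    show "inv h \<in> H" if "h \<in> H" for h
      using that core.m_inv_closed by (auto simp: H_def)
    show "h \<otimes> k \<in> H" if "h \<in> H" "k \<in> H" for h k
      using that core.m_closed by (auto simp: H_def)
  qed
  have H_Int: "h = \<one>" if h: "h \<in> H" "inner_aut G h \<in> P" for h
  proof -
    have "antidiagonal h \<in> M.core \<inter> ?M"
      using h by (auto simp: H_def antidiagonal_def)
    then have "antidiagonal h = \<one>\<^bsub>holomorph\<^esub>"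
      unfolding M.core_Int_M by simp
    then show ?thesis
      using h(1) antidiagonal_eq_one_iff by (simp add: H_def)
  qed
  have one_H: "\<one> \<in> H"
    using subgroup_H by (rule subgroup.one_closed)
  have "closedin T H"
    using closedin_continuous_map_preimage[OF continuous_map_antidiagonal M.closedin_core]
    by (simp add: H_def topspace_eq_carrier)
  moreover have "H \<inter> center G = {\<one>}"
  proof (intro equalityI subsetI)
    fix h assume h: "h \<in> H \<inter> center G"
    then have "inner_aut G h = \<one>\<^bsub>Aut G T\<^esub>"
      using inner_aut_eq_one_iff[of h] by (simp add: center_def)
    then show "h \<in> {\<one>}"
      using H_Int[of h] h by simp
  qed (use one_H in \<open>auto simp: center_def\<close>)
  moreover have "f ` H \<subseteq> H" if f: "f \<in> P" for f
  proof (intro image_subsetI)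
    fix h assume h: "h \<in> H"
    then have hc: "h \<in> carrier G" "antidiagonal h \<in> M.core"
      by (auto simp: H_def)
    have fc: "f \<in> carrier (Aut G T)" "f h \<in> carrier G"
      using f P.subset Aut_closed hc by auto
    have "(\<one>, f) \<otimes>\<^bsub>holomorph\<^esub> antidiagonal h \<otimes>\<^bsub>holomorph\<^esub> inv\<^bsub>holomorph\<^esub> (\<one>, f) \<in> M.core"
      using f hc by (intro M.conjugate_core) auto
    moreover have "(\<one>, f) \<otimes>\<^bsub>holomorph\<^esub> antidiagonal h \<otimes>\<^bsub>holomorph\<^esub> inv\<^bsub>holomorph\<^esub> (\<one>, f) =
        antidiagonal (f h)"
      using fc hc
      by (intro holomorph.conjugate_eqI holomorph_mult_antidiagonal antidiagonal_closed) auto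
    ultimately show "f h \<in> H"
      using fc by (simp add: H_def)
  qed
  moreover have "inner_aut G ` H \<subseteq> Aut_topology G T closure_of P"
    using M.core_subset_closure by (auto simp: H_def antidiagonal_def closure_of_Times)
  moreover have "inner_aut G ` H \<inter> P = {\<one>\<^bsub>Aut G T\<^esub>}"
    using H_Int one_H P.one_closed inner_aut_one by force
  moreover have "H \<noteq> {\<one>}"
  proof
    assume H1: "H = {\<one>}"
    \<comment> \<open>The inverse of the coordinate change \<open>(x, f) \<mapsto> (x, holomorph_action (x, f))\<close>. In the new
      coordinates the antidiagonal is the slice \<open>c = \<one>\<close>, which is compact.\<close>
    define \<Omega> where "\<Omega> = (\<lambda>(x, c). (x, inner_aut G (inv x) \<otimes>\<^bsub>Aut G T\<^esub> c))"
    have \<Omega>_cont: "continuous_map holomorph_topology holomorph_topology \<Omega>"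
      unfolding \<Omega>_def case_prod_unfold continuous_map_paired
      by (intro conjI Aut.continuous_map_mult continuous_map_inner_aut continuous_map_inv
          continuous_map_fst continuous_map_snd)
    have "\<exists>U. openin T' U \<and> \<one>\<^bsub>?S\<^esub> \<in> U \<and> U \<subseteq> V" if V: "openin ?TS V" "\<one>\<^bsub>?S\<^esub> \<in> V" for V
    proof -
      obtain B where B: "openin holomorph_topology B" "V = B \<inter> ?M"
        using V(1) unfolding TS_eq[symmetric] openin_subtopology by auto
      \<comment> \<open>On the antidiagonal, the closures of the \<open>T'\<close>-neighbourhoods \<open>U\<close> of the identity intersect
        in the identity only, so by compactness a single closure is contained in \<open>B\<close> there. By
        the tube lemma this persists where the action is close to the identity, and \<open>T'\<close>-close to
        the identity the action is close to the identity.\<close>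
      define I where "I = {U. openin T' U \<and> \<one>\<^bsub>holomorph\<^esub> \<in> U}"
      define W where "W U = B \<union> (topspace holomorph_topology - holomorph_topology closure_of U)" for U
      define D where "D U = {x \<in> topspace T. \<Omega> (x, \<one>\<^bsub>Aut G T\<^esub>) \<in> W U}" for U
      have W_open: "openin holomorph_topology (W U)" for U
        unfolding W_def
        using B(1) by (intro openin_Un openin_diff openin_topspace closedin_closure_of)
      have D_open: "openin T (D U)" for U
      proof -
        have "continuous_map T holomorph_topology (\<lambda>x. (x, \<one>\<^bsub>Aut G T\<^esub>))"
          unfolding continuous_map_paired by (simp add: topspace_Aut_topology)
        from continuous_map_compose[OF this \<Omega>_cont]
        have "continuous_map T holomorph_topology (\<lambda>x. \<Omega> (x, \<one>\<^bsub>Aut G T\<^esub>))"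
          by (simp add: o_def)
        then show ?thesis
          unfolding D_def using W_open by (rule openin_continuous_map_preimage)
      qed
      have cover: "topspace T \<subseteq> \<Union>(D ` I)"
      proof
        fix x assume x: "x \<in> topspace T"
        then have xc: "x \<in> carrier G"
          by (simp add: topspace_eq_carrier)
        then have \<Omega>x: "\<Omega> (x, \<one>\<^bsub>Aut G T\<^esub>) = antidiagonal (inv x)"
          by (simp add: \<Omega>_def antidiagonal_def inner_aut_in_Aut)
        have M_I: "?M \<in> I"
          using openin_topspace[of T'] by (simp add: I_def M.topspace_T')
        show "x \<in> \<Union>(D ` I)"
        proof (cases "antidiagonal (inv x) \<in> M.core")
          case True
          then have "inv x \<in> H"
            using xc by (simp add: H_def)
          then have "inv x = \<one>"
            using H1 by simp
          then have "antidiagonal (inv x) \<in> B"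
            using V(2) B(2) antidiagonal_one by auto
          then show ?thesis
            using M_I x \<Omega>x by (auto simp: D_def W_def)
        next
          case False
          then obtain U where "U \<in> I" "antidiagonal (inv x) \<notin> holomorph_topology closure_of U"
            unfolding nhds_adherence_def I_def by auto
          moreover have "antidiagonal (inv x) \<in> topspace holomorph_topology"
            unfolding holomorph.topspace_eq_carrier
            using xc by (intro antidiagonal_closed inv_closed)
          ultimately show ?thesis
            using x \<Omega>x by (auto simp: D_def W_def)
        qed
      qed
      have "\<exists>\<F>. finite \<F> \<and> \<F> \<subseteq> D ` I \<and> topspace T \<subseteq> \<Union>\<F>"
        using compact D_open cover unfolding compact_space_def by (intro compactinD) auto
      then obtain J where J: "finite J" "J \<subseteq> I" "topspace T \<subseteq> \<Union>(D ` J)"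
        by (metis finite_subset_image)
      define U0 where "U0 = ?M \<inter> \<Inter>J"
      have U0: "openin T' U0" "\<one>\<^bsub>holomorph\<^esub> \<in> U0" "U0 \<subseteq> ?M"
        unfolding U0_def using J openin_Int_Inter[of J T' ?M] openin_topspace[of T']
        by (auto simp: I_def M.topspace_T')
      have "D U \<subseteq> D U0" if "U \<in> J" for U
        using closure_of_mono[of U0 U holomorph_topology] that by (auto simp: U0_def D_def W_def)
      then have "topspace T \<subseteq> D U0"
        using J(3) by blast
      then have slice: "topspace T \<times> {\<one>\<^bsub>Aut G T\<^esub>} \<subseteq>
          {q \<in> topspace holomorph_topology. \<Omega> q \<in> W U0}" (is "_ \<subseteq> ?E")
        by (auto simp: D_def topspace_Aut_topology)
      have open_E: "openin holomorph_topology ?E"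
        using \<Omega>_cont W_open by (rule openin_continuous_map_preimage)
      have one_compact: "compactin (Aut_topology G T) {\<one>\<^bsub>Aut G T\<^esub>}"
        by (simp add: topspace_Aut_topology)
      obtain C' C where "openin T C'" and C: "openin (Aut_topology G T) C" "topspace T \<subseteq> C'"
        "{\<one>\<^bsub>Aut G T\<^esub>} \<subseteq> C" "C' \<times> C \<subseteq> ?E"
        by (rule Wallace_theorem_prod_topology
            [OF compact[unfolded compact_space_def] one_compact open_E slice])
      define U where "U = U0 \<inter> {q \<in> topspace T'. holomorph_action q \<in> C}"
      have "openin T' U"
        unfolding U_def
        using U0(1) openin_continuous_map_preimage[OF act_cont C(1)] by (rule openin_Int)
      moreover have "\<one>\<^bsub>?S\<^esub> \<in> U"
        using U0(2) C(3) by (simp add: U_def M.topspace_T' holomorph_action_def inner_aut_one)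
      moreover have "U \<subseteq> V"
      proof
        fix q assume q: "q \<in> U"
        then have qM: "q \<in> ?M"
          using U0(3) by (auto simp: U_def)
        then obtain x f where xf: "q = (x, f)" "x \<in> carrier G" "f \<in> carrier (Aut G T)"
          using P.subset by auto
        have "(x, holomorph_action q) \<in> C' \<times> C"
          using q C(2) xf by (auto simp: U_def topspace_eq_carrier)
        then have "\<Omega> (x, holomorph_action q) \<in> W U0"
          using C(4) by auto
        moreover have "\<Omega> (x, holomorph_action q) = q"
          using eq_inner_aut_inv_mult_holomorph_action[OF xf(2,3)] xf(1) by (simp add: \<Omega>_def)
        moreover have "U0 \<subseteq> holomorph_topology closure_of U0"
          using U0(3) M.M_subset holomorph.topspace_eq_carrier by (intro closure_of_subset) auto
        ultimately have "q \<in> B"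
          using q by (auto simp: W_def U_def)
        then show "q \<in> V"
          using B(2) qM by simp
      qed
      ultimately show ?thesis
        by blast
    qed
    then have "openin T' V" if "openin ?TS V" for V
      using S.finer_if_finer_at_one[OF T'(1) _ that] by simp
    then have "T' = ?TS"
      using T'(2) by (auto simp: topology_eq)
    then show False
      using T'(3) by simp
  qed
  ultimately show ?thesis
    using subgroup_H by (intro exI[of _ H]) simp
qed

end

theorem theorem5p2:
  fixes G :: "('a, 'b) monoid_scheme" and T :: "'a topology" and P :: "('a \<Rightarrow> 'a) set"
  assumes "topological_group G T"
    and "compact_space T"
    and "subgroup P (Aut G T)"
  shows "\<not> minimal_topological_group (semidirect G T P) (semidirect_topology G T P) \<longleftrightarrow>
    (\<exists>H. subgroup H G \<and> closedin T H \<and> H \<noteq> {\<one>\<^bsub>G\<^esub>} \<and>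
         H \<inter> center G = {\<one>\<^bsub>G\<^esub>} \<and>
         (\<forall>f \<in> P. f ` H \<subseteq> H) \<and>
         inner_aut G ` H \<subseteq> (Aut_topology G T) closure_of P \<and>
         inner_aut G ` H \<inter> P = {\<one>\<^bsub>Aut G T\<^esub>})"
proof -
  interpret compact_topological_group G T
    using assms by (simp add: compact_topological_group_def compact_topological_group_axioms_def)
  show ?thesis
    (is "?not_minimal \<longleftrightarrow> (\<exists>H. ?normal H)")
  proof
    show "\<exists>H. ?normal H" if ?not_minimal
      using assms(3) that by (rule subgroup_if_not_minimal)
    show ?not_minimal if "\<exists>H. ?normal H"
    proof -
      from that obtain H where "?normal H" ..
      then show ?thesis
        by (intro not_minimal_if_subgroup[OF assms(3), of H]) simp_all
    qed
  qed
qed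

end
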